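(* Let $\mathcal{M}$ be a (small) strict braided monoidal category whose unit object $I_{\mathcal{M}}$ is null (both initial and terminal), and suppose that $\mathcal{M}$ is generated by an object $x\in\mathrm{ob}(\mathcal{M})$ in the sense that every object of $\mathcal{M}$ is isomorphic to $x^{\oplus n}$ for some non-negative integer $n$. Let $\mathcal{C}$ be a (small) strict left-module over $\mathcal{M}$, let $\mathcal{A}$ be an abelian category and let $T\colon\mathcal{C}\to\mathcal{A}$ be a functor. Then $\deg^x(T)=\deg(T)$, where $\deg(T)$ is the degree of $T$ with respect to all the stabilisers $(s_y,\imath_y)$, $y\in\mathrm{ob}(\mathcal{M})$, of $\mathcal{C}$, and $\deg^x(T)$ is the degree of $T$ with respect to the single stabiliser $(s_x,\imath_x)$.
   Context: A strict left-module over a strict monoidal category $\mathcal{M}$ is a category $\mathcal{C}$ with a functor $\oplus\colon\mathcal{M}\times\mathcal{C}\to\mathcal{C}$ that is strictly unital ($I_{\mathcal{M}}\oplus -=\mathrm{id}_{\mathcal{C}}$) and strictly associative ($y\oplus(z\oplus c)=(y\oplus z)\oplus c$, on objects and morphisms). When $I_{\mathcal{M}}$ is initial, each $y\in\mathrm{ob}(\mathcal{M})$ gives an endofunctor $s_y=y\oplus -\colon\mathcal{C}\to\mathcal{C}$ and a natural transformation $\imath_y\colon\mathrm{id}_{\mathcal{C}}\to s_y$ with components $i_y\oplus\mathrm{id}_c\colon c=I_{\mathcal{M}}\oplus c\to y\oplus c$, where $i_y\colon I_{\mathcal{M}}\to y$ is the unique morphism. Degree: given a small category $\mathcal{C}$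 with a family of endofunctors $s_i$ and natural transformations $\imath_i\colon\mathrm{id}\to s_i$ ($i\in I$), the degree in $\{-1,0,1,\ldots,\infty\}$ of a functor $T\colon\mathcal{C}\to\mathcal{A}$ is defined recursively: $\deg(T)\leq -1$ iff $T=0$; for $d\geq 0$, $\deg(T)\leq d$ iff $\deg(\mathrm{coker}(T\imath_i\colon T\to Ts_i))\leq d-1$ for all $i\in I$; $\deg(T)=\infty$ if $\deg(T)\leq d$ for no finite $d$. *)

theory Defs
  imports "HOL-Algebra.Group" "HOL-Library.Extended_Real"
begin

section \<open>Categories, functors and natural transformations\<close>

text \<open>
  Objects and arrows form sets inside ambient types, so every category below is small relative
  to its types. The values of the operations outside \<open>Ob\<close>, \<open>Arr\<close> and outside composable
  pairs are irrelevant.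
\<close>

record ('o, 'a) cat =
  Ob :: "'o set"
  Arr :: "'a set"
  Dom :: "'a \<Rightarrow> 'o"
  Cod :: "'a \<Rightarrow> 'o"
  Ident :: "'o \<Rightarrow> 'a"
  Comp :: "'a \<Rightarrow> 'a \<Rightarrow> 'a"  (infixr \<open>\<cdot>\<index>\<close> 70)

definition homset :: "('o, 'a, 'z) cat_scheme \<Rightarrow> 'o \<Rightarrow> 'o \<Rightarrow> 'a set" where
  "homset C X Y = {f \<in> Arr C. Dom C f = X \<and> Cod C f = Y}"

locale category =
  fixes C :: "('o, 'a, 'z) cat_scheme"
  assumes Dom_in_Ob: "f \<in> Arr C \<Longrightarrow> Dom C f \<in> Ob C"
    and Cod_in_Ob: "f \<in> Arr C \<Longrightarrow> Cod C f \<in> Ob C"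
    and Ident_in_homset: "X \<in> Ob C \<Longrightarrow> Ident C X \<in> homset C X X"
    and Comp_in_homset:
      "f \<in> homset C X Y \<Longrightarrow> g \<in> homset C Y Z \<Longrightarrow> g \<cdot>\<^bsub>C\<^esub> f \<in> homset C X Z"
    and Ident_left: "f \<in> homset C X Y \<Longrightarrow> Ident C Y \<cdot>\<^bsub>C\<^esub> f = f"
    and Ident_right: "f \<in> homset C X Y \<Longrightarrow> f \<cdot>\<^bsub>C\<^esub> Ident C X = f"
    and Comp_assoc:
      "f \<in> homset C W X \<Longrightarrow> g \<in> homset C X Y \<Longrightarrow> h \<in> homset C Y Z \<Longrightarrow>
        (h \<cdot>\<^bsub>C\<^esub> g) \<cdot>\<^bsub>C\<^esub> f = h \<cdot>\<^bsub>C\<^esub> (g \<cdot>\<^bsub>C\<^esub> f)"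

definition isomorphism :: "('o, 'a, 'z) cat_scheme \<Rightarrow> 'a \<Rightarrow> bool" where
  "isomorphism C f \<longleftrightarrow> f \<in> Arr C \<and>
    (\<exists>g \<in> homset C (Cod C f) (Dom C f).
      g \<cdot>\<^bsub>C\<^esub> f = Ident C (Dom C f) \<and> f \<cdot>\<^bsub>C\<^esub> g = Ident C (Cod C f))"

definition isomorphic :: "('o, 'a, 'z) cat_scheme \<Rightarrow> 'o \<Rightarrow> 'o \<Rightarrow> bool" where
  "isomorphic C X Y \<longleftrightarrow> (\<exists>f \<in> homset C X Y. isomorphism C f)"

definition initial_object :: "('o, 'a, 'z) cat_scheme \<Rightarrow> 'o \<Rightarrow> bool" where
  "initial_object C X \<longleftrightarrow> X \<in> Ob C \<and> (\<forall>Y \<in> Ob C. \<exists>!f. f \<in> homset C X Y)"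

definition terminal_object :: "('o, 'a, 'z) cat_scheme \<Rightarrow> 'o \<Rightarrow> bool" where
  "terminal_object C X \<longleftrightarrow> X \<in> Ob C \<and> (\<forall>Y \<in> Ob C. \<exists>!f. f \<in> homset C Y X)"

definition null_object :: "('o, 'a, 'z) cat_scheme \<Rightarrow> 'o \<Rightarrow> bool" where
  "null_object C X \<longleftrightarrow> initial_object C X \<and> terminal_object C X"

definition monic :: "('o, 'a, 'z) cat_scheme \<Rightarrow> 'a \<Rightarrow> bool" where
  "monic C f \<longleftrightarrow> f \<in> Arr C \<and>
    (\<forall>W. \<forall>g \<in> homset C W (Dom C f). \<forall>h \<in> homset C W (Dom C f).
      f \<cdot>\<^bsub>C\<^esub> g = f \<cdot>\<^bsub>C\<^esub> h \<longrightarrow> g = h)"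

definition epic :: "('o, 'a, 'z) cat_scheme \<Rightarrow> 'a \<Rightarrow> bool" where
  "epic C f \<longleftrightarrow> f \<in> Arr C \<and>
    (\<forall>Z. \<forall>g \<in> homset C (Cod C f) Z. \<forall>h \<in> homset C (Cod C f) Z.
      g \<cdot>\<^bsub>C\<^esub> f = h \<cdot>\<^bsub>C\<^esub> f \<longrightarrow> g = h)"

definition prod_cat ::
  "('o1, 'a1, 'z1) cat_scheme \<Rightarrow> ('o2, 'a2, 'z2) cat_scheme \<Rightarrow> ('o1 \<times> 'o2, 'a1 \<times> 'a2) cat" where
  "prod_cat C D =
    \<lparr>Ob = Ob C \<times> Ob D, Arr = Arr C \<times> Arr D,
     Dom = map_prod (Dom C) (Dom D), Cod = map_prod (Cod C) (Cod D),
     Ident = map_prod (Ident C) (Ident D),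
     Comp = (\<lambda>g f. (fst g \<cdot>\<^bsub>C\<^esub> fst f, snd g \<cdot>\<^bsub>D\<^esub> snd f))\<rparr>"

record ('o1, 'a1, 'o2, 'a2) fctr =
  on_Ob :: "'o1 \<Rightarrow> 'o2"
  on_Arr :: "'a1 \<Rightarrow> 'a2"

locale is_functor =
  src: category C + tgt: category D
  for C :: "('o1, 'a1, 'z1) cat_scheme"
    and D :: "('o2, 'a2, 'z2) cat_scheme"
    and F :: "('o1, 'a1, 'o2, 'a2) fctr" +
  assumes on_Ob_in_Ob: "X \<in> Ob C \<Longrightarrow> on_Ob F X \<in> Ob D"
    and on_Arr_in_homset:
      "f \<in> homset C X Y \<Longrightarrow> on_Arr F f \<in> homset D (on_Ob F X) (on_Ob F Y)"
    and on_Arr_Ident: "X \<in> Ob C \<Longrightarrow> on_Arr F (Ident C X) = Ident D (on_Ob F X)"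
    and on_Arr_Comp:
      "f \<in> homset C X Y \<Longrightarrow> g \<in> homset C Y Z \<Longrightarrow>
        on_Arr F (g \<cdot>\<^bsub>C\<^esub> f) = on_Arr F g \<cdot>\<^bsub>D\<^esub> on_Arr F f"

definition comp_fctr ::
  "('o2, 'a2, 'o3, 'a3) fctr \<Rightarrow> ('o1, 'a1, 'o2, 'a2) fctr \<Rightarrow> ('o1, 'a1, 'o3, 'a3) fctr" where
  "comp_fctr G F = \<lparr>on_Ob = on_Ob G \<circ> on_Ob F, on_Arr = on_Arr G \<circ> on_Arr F\<rparr>"

definition id_fctr :: "('o, 'a, 'o, 'a) fctr" where
  "id_fctr = \<lparr>on_Ob = id, on_Arr = id\<rparr>"

definition swap_fctr :: "('o1 \<times> 'o2, 'a1 \<times> 'a2, 'o2 \<times> 'o1, 'a2 \<times> 'a1) fctr" where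
  "swap_fctr = \<lparr>on_Ob = prod.swap, on_Arr = prod.swap\<rparr>"

locale natural_transformation =
  F: is_functor C D F + G: is_functor C D G
  for C :: "('o1, 'a1, 'z1) cat_scheme"
    and D :: "('o2, 'a2, 'z2) cat_scheme"
    and F :: "('o1, 'a1, 'o2, 'a2) fctr"
    and G :: "('o1, 'a1, 'o2, 'a2) fctr"
    and \<tau> :: "'o1 \<Rightarrow> 'a2" +
  assumes component_in_homset: "X \<in> Ob C \<Longrightarrow> \<tau> X \<in> homset D (on_Ob F X) (on_Ob G X)"
    and naturality:
      "f \<in> homset C X Y \<Longrightarrow> \<tau> Y \<cdot>\<^bsub>D\<^esub> on_Arr F f = on_Arr G f \<cdot>\<^bsub>D\<^esub> \<tau> X"


section \<open>Strict braided monoidal categories and their strict left-modules\<close>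

record ('o, 'a) monoidal_cat = "('o, 'a) cat" +
  Tensor :: "('o \<times> 'o, 'a \<times> 'a, 'o, 'a) fctr"
  Unit :: 'o

record ('o, 'a) braided_cat = "('o, 'a) monoidal_cat" +
  Braiding :: "'o \<times> 'o \<Rightarrow> 'a"

abbreviation tensor_Ob ::
  "('o, 'a, 'z) monoidal_cat_scheme \<Rightarrow> 'o \<Rightarrow> 'o \<Rightarrow> 'o" where
  "tensor_Ob M X Y \<equiv> on_Ob (Tensor M) (X, Y)"

abbreviation tensor_Arr ::
  "('o, 'a, 'z) monoidal_cat_scheme \<Rightarrow> 'a \<Rightarrow> 'a \<Rightarrow> 'a" where
  "tensor_Arr M f g \<equiv> on_Arr (Tensor M) (f, g)"

locale strict_monoidal_category =
  category M + tensor: is_functor "prod_cat M M" M "Tensor M"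
  for M :: "('o, 'a, 'z) monoidal_cat_scheme" +
  assumes Unit_in_Ob: "Unit M \<in> Ob M"
    and Unit_left_Ob: "X \<in> Ob M \<Longrightarrow> tensor_Ob M (Unit M) X = X"
    and Unit_left_Arr: "f \<in> Arr M \<Longrightarrow> tensor_Arr M (Ident M (Unit M)) f = f"
    and Unit_right_Ob: "X \<in> Ob M \<Longrightarrow> tensor_Ob M X (Unit M) = X"
    and Unit_right_Arr: "f \<in> Arr M \<Longrightarrow> tensor_Arr M f (Ident M (Unit M)) = f"
    and tensor_assoc_Ob:
      "X \<in> Ob M \<Longrightarrow> Y \<in> Ob M \<Longrightarrow> Z \<in> Ob M \<Longrightarrow>
        tensor_Ob M X (tensor_Ob M Y Z) = tensor_Ob M (tensor_Ob M X Y) Z"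
    and tensor_assoc_Arr:
      "f \<in> Arr M \<Longrightarrow> g \<in> Arr M \<Longrightarrow> h \<in> Arr M \<Longrightarrow>
        tensor_Arr M f (tensor_Arr M g h) = tensor_Arr M (tensor_Arr M f g) h"

text \<open>
  A braiding on a strict monoidal category: a natural isomorphism with components
  \<open>X \<otimes> Y \<rightarrow> Y \<otimes> X\<close> satisfying the two hexagon identities, in which the associators
  are identities.
\<close>

locale strict_braided_monoidal_category =
  strict_monoidal_category M +
  braiding: natural_transformation "prod_cat M M" M "Tensor M" "comp_fctr (Tensor M) swap_fctr"
    "Braiding M"
  for M :: "('o, 'a, 'z) braided_cat_scheme" +
  assumes Braiding_iso: "X \<in> Ob M \<Longrightarrow> Y \<in> Ob M \<Longrightarrow> isomorphism M (Braiding M (X, Y))"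
    and hexagon_right:
      "X \<in> Ob M \<Longrightarrow> Y \<in> Ob M \<Longrightarrow> Z \<in> Ob M \<Longrightarrow>
        Braiding M (X, tensor_Ob M Y Z) =
          tensor_Arr M (Ident M Y) (Braiding M (X, Z)) \<cdot>\<^bsub>M\<^esub>
          tensor_Arr M (Braiding M (X, Y)) (Ident M Z)"
    and hexagon_left:
      "X \<in> Ob M \<Longrightarrow> Y \<in> Ob M \<Longrightarrow> Z \<in> Ob M \<Longrightarrow>
        Braiding M (tensor_Ob M X Y, Z) =
          tensor_Arr M (Braiding M (X, Z)) (Ident M Y) \<cdot>\<^bsub>M\<^esub>
          tensor_Arr M (Ident M X) (Braiding M (Y, Z))"

primrec tensor_power :: "('o, 'a, 'z) monoidal_cat_scheme \<Rightarrow> 'o \<Rightarrow> nat \<Rightarrow> 'o" where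
  "tensor_power M X 0 = Unit M"
| "tensor_power M X (Suc n) = tensor_Ob M X (tensor_power M X n)"

definition generated_by :: "('o, 'a, 'z) monoidal_cat_scheme \<Rightarrow> 'o \<Rightarrow> bool" where
  "generated_by M X \<longleftrightarrow> X \<in> Ob M \<and> (\<forall>Y \<in> Ob M. \<exists>n. isomorphic M Y (tensor_power M X n))"

locale strict_left_module =
  strict_monoidal_category M + module: category C + action: is_functor "prod_cat M C" C act
  for M :: "('mo, 'ma, 'z) monoidal_cat_scheme"
    and C :: "('co, 'ca, 'y) cat_scheme"
    and act :: "('mo \<times> 'co, 'ma \<times> 'ca, 'co, 'ca) fctr" +
  assumes act_Unit_Ob: "c \<in> Ob C \<Longrightarrow> on_Ob act (Unit M, c) = c"
    and act_Unit_Arr: "f \<in> Arr C \<Longrightarrow> on_Arr act (Ident M (Unit M), f) = f"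
    and act_assoc_Ob:
      "Y \<in> Ob M \<Longrightarrow> Z \<in> Ob M \<Longrightarrow> c \<in> Ob C \<Longrightarrow>
        on_Ob act (Y, on_Ob act (Z, c)) = on_Ob act (tensor_Ob M Y Z, c)"
    and act_assoc_Arr:
      "u \<in> Arr M \<Longrightarrow> v \<in> Arr M \<Longrightarrow> f \<in> Arr C \<Longrightarrow>
        on_Arr act (u, on_Arr act (v, f)) = on_Arr act (tensor_Arr M u v, f)"

definition stab ::
  "('mo, 'ma, 'z) monoidal_cat_scheme \<Rightarrow> ('mo \<times> 'co, 'ma \<times> 'ca, 'co, 'ca) fctr \<Rightarrow>
    'mo \<Rightarrow> ('co, 'ca, 'co, 'ca) fctr" where
  "stab M act y =
    \<lparr>on_Ob = (\<lambda>c. on_Ob act (y, c)), on_Arr = (\<lambda>f. on_Arr act (Ident M y, f))\<rparr>"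

definition from_Unit :: "('mo, 'ma, 'z) monoidal_cat_scheme \<Rightarrow> 'mo \<Rightarrow> 'ma" where
  "from_Unit M y = (THE f. f \<in> homset M (Unit M) y)"

definition stab_trans ::
  "('mo, 'ma, 'z) monoidal_cat_scheme \<Rightarrow> ('co, 'ca, 'y) cat_scheme \<Rightarrow>
    ('mo \<times> 'co, 'ma \<times> 'ca, 'co, 'ca) fctr \<Rightarrow> 'mo \<Rightarrow> 'co \<Rightarrow> 'ca" where
  "stab_trans M C act y c = on_Arr act (from_Unit M y, Ident C c)"


section \<open>Abelian categories\<close>

record ('o, 'a) ab_cat = "('o, 'a) cat" +
  Plus :: "'a \<Rightarrow> 'a \<Rightarrow> 'a"
  Zero :: "'o \<Rightarrow> 'o \<Rightarrow> 'a"

definition hom_group :: "('o, 'a, 'z) ab_cat_scheme \<Rightarrow> 'o \<Rightarrow> 'o \<Rightarrow> 'a monoid" where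
  "hom_group A X Y = \<lparr>carrier = homset A X Y, mult = Plus A, one = Zero A X Y\<rparr>"

definition is_kernel :: "('o, 'a, 'z) ab_cat_scheme \<Rightarrow> 'a \<Rightarrow> 'a \<Rightarrow> bool" where
  "is_kernel A f k \<longleftrightarrow> f \<in> Arr A \<and> k \<in> Arr A \<and> Cod A k = Dom A f \<and>
    f \<cdot>\<^bsub>A\<^esub> k = Zero A (Dom A k) (Cod A f) \<and>
    (\<forall>W \<in> Ob A. \<forall>g \<in> homset A W (Dom A f). f \<cdot>\<^bsub>A\<^esub> g = Zero A W (Cod A f) \<longrightarrow>
      (\<exists>!h. h \<in> homset A W (Dom A k) \<and> k \<cdot>\<^bsub>A\<^esub> h = g))"

definition is_cokernel :: "('o, 'a, 'z) ab_cat_scheme \<Rightarrow> 'a \<Rightarrow> 'a \<Rightarrow> bool" where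
  "is_cokernel A f p \<longleftrightarrow> f \<in> Arr A \<and> p \<in> Arr A \<and> Dom A p = Cod A f \<and>
    p \<cdot>\<^bsub>A\<^esub> f = Zero A (Dom A f) (Cod A p) \<and>
    (\<forall>Z \<in> Ob A. \<forall>g \<in> homset A (Cod A f) Z. g \<cdot>\<^bsub>A\<^esub> f = Zero A (Dom A f) Z \<longrightarrow>
      (\<exists>!h. h \<in> homset A (Cod A p) Z \<and> h \<cdot>\<^bsub>A\<^esub> p = g))"

locale abelian_category =
  category A for A :: "('o, 'a, 'z) ab_cat_scheme" +
  assumes hom_comm_group: "X \<in> Ob A \<Longrightarrow> Y \<in> Ob A \<Longrightarrow> comm_group (hom_group A X Y)"
    and Comp_Plus_right:
      "f \<in> homset A X Y \<Longrightarrow> f' \<in> homset A X Y \<Longrightarrow> g \<in> homset A Y Z \<Longrightarrow>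
        g \<cdot>\<^bsub>A\<^esub> Plus A f f' = Plus A (g \<cdot>\<^bsub>A\<^esub> f) (g \<cdot>\<^bsub>A\<^esub> f')"
    and Comp_Plus_left:
      "f \<in> homset A X Y \<Longrightarrow> g \<in> homset A Y Z \<Longrightarrow> g' \<in> homset A Y Z \<Longrightarrow>
        Plus A g g' \<cdot>\<^bsub>A\<^esub> f = Plus A (g \<cdot>\<^bsub>A\<^esub> f) (g' \<cdot>\<^bsub>A\<^esub> f)"
    and null_object_exists: "\<exists>N. null_object A N"
    and biproduct_exists:
      "X \<in> Ob A \<Longrightarrow> Y \<in> Ob A \<Longrightarrow>
        \<exists>B \<in> Ob A. \<exists>i \<in> homset A X B. \<exists>j \<in> homset A Y B.
          \<exists>p \<in> homset A B X. \<exists>q \<in> homset A B Y.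
            p \<cdot>\<^bsub>A\<^esub> i = Ident A X \<and> q \<cdot>\<^bsub>A\<^esub> j = Ident A Y \<and>
            Plus A (i \<cdot>\<^bsub>A\<^esub> p) (j \<cdot>\<^bsub>A\<^esub> q) = Ident A B"
    and kernel_exists: "f \<in> Arr A \<Longrightarrow> \<exists>k. is_kernel A f k"
    and cokernel_exists: "f \<in> Arr A \<Longrightarrow> \<exists>p. is_cokernel A f p"
    and monic_is_kernel: "monic A k \<Longrightarrow> \<exists>f. is_kernel A f k"
    and epic_is_cokernel: "epic A p \<Longrightarrow> \<exists>f. is_cokernel A f p"


section \<open>Degree of a functor\<close>

definition coker_proj :: "('o, 'a, 'z) ab_cat_scheme \<Rightarrow> 'a \<Rightarrow> 'a" where
  "coker_proj A f = (SOME p. is_cokernel A f p)"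

text \<open>
  The cokernel of a natural transformation \<open>\<tau>\<close> into the functor \<open>G\<close>, formed objectwise from
  chosen cokernels; the action on arrows is the one induced by \<open>G\<close>.
\<close>

definition coker_fctr ::
  "('o1, 'a1, 'z1) cat_scheme \<Rightarrow> ('o2, 'a2, 'z2) ab_cat_scheme \<Rightarrow>
    ('o1, 'a1, 'o2, 'a2) fctr \<Rightarrow> ('o1 \<Rightarrow> 'a2) \<Rightarrow> ('o1, 'a1, 'o2, 'a2) fctr" where
  "coker_fctr C A G \<tau> =
    \<lparr>on_Ob = (\<lambda>c. Cod A (coker_proj A (\<tau> c))),
     on_Arr = (\<lambda>f. THE h.
       h \<in> homset A (Cod A (coker_proj A (\<tau> (Dom C f)))) (Cod A (coker_proj A (\<tau> (Cod C f)))) \<and>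
       h \<cdot>\<^bsub>A\<^esub> coker_proj A (\<tau> (Dom C f)) = coker_proj A (\<tau> (Cod C f)) \<cdot>\<^bsub>A\<^esub> on_Arr G f)\<rparr>"

text \<open>Since cokernels are only determined up to isomorphism, so is the condition \<open>T = 0\<close>.\<close>

definition zero_fctr ::
  "('o1, 'a1, 'z1) cat_scheme \<Rightarrow> ('o2, 'a2, 'z2) ab_cat_scheme \<Rightarrow>
    ('o1, 'a1, 'o2, 'a2) fctr \<Rightarrow> bool" where
  "zero_fctr C A T \<longleftrightarrow> (\<forall>c \<in> Ob C. null_object A (on_Ob T c))"

text \<open>
  \<open>degree_lt C A I s \<iota> n T\<close> is the recursively defined condition \<open>deg T \<le> n - 1\<close>, the
  bound being shifted by one so that the recursion runs over the natural numbers and starts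
  at \<open>deg T \<le> -1\<close>.
\<close>

primrec degree_lt ::
  "('o1, 'a1, 'z1) cat_scheme \<Rightarrow> ('o2, 'a2, 'z2) ab_cat_scheme \<Rightarrow> 'i set \<Rightarrow>
    ('i \<Rightarrow> ('o1, 'a1, 'o1, 'a1) fctr) \<Rightarrow> ('i \<Rightarrow> 'o1 \<Rightarrow> 'a1) \<Rightarrow>
    nat \<Rightarrow> ('o1, 'a1, 'o2, 'a2) fctr \<Rightarrow> bool" where
  "degree_lt C A I s \<iota> 0 T \<longleftrightarrow> zero_fctr C A T"
| "degree_lt C A I s \<iota> (Suc n) T \<longleftrightarrow>
    (\<forall>i \<in> I. degree_lt C A I s \<iota> n (coker_fctr C A (comp_fctr T (s i)) (\<lambda>c. on_Arr T (\<iota> i c))))"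

text \<open>The infimum of the empty set is \<open>\<infinity>\<close>.\<close>

definition degree ::
  "('o1, 'a1, 'z1) cat_scheme \<Rightarrow> ('o2, 'a2, 'z2) ab_cat_scheme \<Rightarrow> 'i set \<Rightarrow>
    ('i \<Rightarrow> ('o1, 'a1, 'o1, 'a1) fctr) \<Rightarrow> ('i \<Rightarrow> 'o1 \<Rightarrow> 'a1) \<Rightarrow>
    ('o1, 'a1, 'o2, 'a2) fctr \<Rightarrow> ereal" where
  "degree C A I s \<iota> T = Inf {ereal (real n - 1) | n. degree_lt C A I s \<iota> n T}"


section \<open>Well-definedness\<close>

text \<open>
  The stabilisers are natural transformations, objectwise cokernels are functors, and the degree
  is bounded by \<open>n - 1\<close> exactly when the recursive condition \<open>degree_lt\<close> holds for \<open>n\<close>.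
\<close>

lemma (in category) homset_Ob:
  assumes "f \<in> homset C X Y" shows "X \<in> Ob C" "Y \<in> Ob C"
  using assms Dom_in_Ob Cod_in_Ob by (auto simp: homset_def)

lemma is_functor_comp_fctr:
  assumes "is_functor C D F" "is_functor D E G"
  shows "is_functor C E (comp_fctr G F)"
proof -
  interpret F: is_functor C D F by fact
  interpret G: is_functor D E G by fact
  show ?thesis
  proof unfold_locales
    fix f X Y g Z assume f: "f \<in> homset C X Y" and g: "g \<in> homset C Y Z"
    show "on_Arr (comp_fctr G F) (g \<cdot>\<^bsub>C\<^esub> f) = on_Arr (comp_fctr G F) g \<cdot>\<^bsub>E\<^esub> on_Arr (comp_fctr G F) f"
      using G.on_Arr_Comp[OF F.on_Arr_in_homset[OF f] F.on_Arr_in_homset[OF g]] F.on_Arr_Comp[OF f g]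
      by (simp add: comp_fctr_def)
  qed (auto simp: comp_fctr_def F.on_Ob_in_Ob G.on_Ob_in_Ob F.on_Arr_Ident G.on_Arr_Ident
        intro: F.on_Arr_in_homset G.on_Arr_in_homset)
qed

lemma natural_transformation_whisker:
  assumes "natural_transformation C C id_fctr s \<iota>" "is_functor C A T"
  shows "natural_transformation C A T (comp_fctr T s) (\<lambda>c. on_Arr T (\<iota> c))"
proof -
  interpret n: natural_transformation C C id_fctr s \<iota> by fact
  interpret T: is_functor C A T by fact
  interpret Ts: is_functor C A "comp_fctr T s"
    by (rule is_functor_comp_fctr[OF n.G.is_functor_axioms assms(2)])
  show ?thesis
  proof unfold_locales
    fix X assume "X \<in> Ob C"
    then show "on_Arr T (\<iota> X) \<in> homset A (on_Ob T X) (on_Ob (comp_fctr T s) X)"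
      using n.component_in_homset T.on_Arr_in_homset by (force simp: comp_fctr_def id_fctr_def)
  next
    fix f X Y assume f: "f \<in> homset C X Y"
    note XY = n.F.src.homset_Ob[OF f]
    have i: "\<iota> X \<in> homset C X (on_Ob s X)" "\<iota> Y \<in> homset C Y (on_Ob s Y)"
      using XY n.component_in_homset by (auto simp: id_fctr_def)
    show "on_Arr T (\<iota> Y) \<cdot>\<^bsub>A\<^esub> on_Arr T f = on_Arr (comp_fctr T s) f \<cdot>\<^bsub>A\<^esub> on_Arr T (\<iota> X)"
      using n.naturality[OF f] T.on_Arr_Comp[OF f i(2)]
        T.on_Arr_Comp[OF i(1) n.G.on_Arr_in_homset[OF f]]
      by (simp add: comp_fctr_def id_fctr_def)
  qed
qed

context abelian_category begin

lemma Zero_in_homset: "X \<in> Ob A \<Longrightarrow> Y \<in> Ob A \<Longrightarrow> Zero A X Y \<in> homset A X Y"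
  using monoid.one_closed[OF group.is_monoid[OF comm_group.axioms(2)[OF hom_comm_group]]]
  by (simp add: hom_group_def)

lemma Comp_Zero_right:
  assumes X: "X \<in> Ob A" and g: "g \<in> homset A Y Z"
  shows "g \<cdot>\<^bsub>A\<^esub> Zero A X Y = Zero A X Z"
proof -
  note YZ = homset_Ob[OF g]
  interpret XY: comm_group "hom_group A X Y" using X YZ hom_comm_group by blast
  interpret XZ: comm_group "hom_group A X Z" using X YZ hom_comm_group by blast
  let ?z = "Zero A X Y"
  have z: "?z \<in> homset A X Y" using X YZ Zero_in_homset by blast
  have "Plus A ?z ?z = ?z" using XY.l_one[of ?z] z by (simp add: hom_group_def)
  then have e: "Plus A (g \<cdot>\<^bsub>A\<^esub> ?z) (g \<cdot>\<^bsub>A\<^esub> ?z) = g \<cdot>\<^bsub>A\<^esub> ?z"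
    using Comp_Plus_right[OF z z g] by simp
  have "g \<cdot>\<^bsub>A\<^esub> ?z \<in> carrier (hom_group A X Z)"
    using Comp_in_homset[OF z g] by (simp add: hom_group_def)
  then show ?thesis using XZ.l_cancel_one[of "g \<cdot>\<^bsub>A\<^esub> ?z" "g \<cdot>\<^bsub>A\<^esub> ?z"] e by (simp add: hom_group_def)
qed

lemma Comp_Zero_left:
  assumes Z: "Z \<in> Ob A" and f: "f \<in> homset A X Y"
  shows "Zero A Y Z \<cdot>\<^bsub>A\<^esub> f = Zero A X Z"
proof -
  note XY = homset_Ob[OF f]
  interpret YZ: comm_group "hom_group A Y Z" using Z XY hom_comm_group by blast
  interpret XZ: comm_group "hom_group A X Z" using Z XY hom_comm_group by blast
  let ?z = "Zero A Y Z"
  have z: "?z \<in> homset A Y Z" using Z XY Zero_in_homset by blast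
  have "Plus A ?z ?z = ?z" using YZ.l_one[of ?z] z by (simp add: hom_group_def)
  then have e: "Plus A (?z \<cdot>\<^bsub>A\<^esub> f) (?z \<cdot>\<^bsub>A\<^esub> f) = ?z \<cdot>\<^bsub>A\<^esub> f"
    using Comp_Plus_left[OF f z z] by simp
  have "?z \<cdot>\<^bsub>A\<^esub> f \<in> carrier (hom_group A X Z)"
    using Comp_in_homset[OF f z] by (simp add: hom_group_def)
  then show ?thesis using XZ.l_cancel_one[of "?z \<cdot>\<^bsub>A\<^esub> f" "?z \<cdot>\<^bsub>A\<^esub> f"] e by (simp add: hom_group_def)
qed

lemma is_cokernel_coker_proj: "f \<in> Arr A \<Longrightarrow> is_cokernel A f (coker_proj A f)"
  unfolding coker_proj_def using cokernel_exists by (rule someI_ex)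

lemma coker_proj_in_homset:
  "f \<in> homset A X Y \<Longrightarrow> coker_proj A f \<in> homset A Y (Cod A (coker_proj A f))"
  using is_cokernel_coker_proj[of f] by (simp add: is_cokernel_def homset_def)

lemma coker_proj_Comp:
  "f \<in> homset A X Y \<Longrightarrow> coker_proj A f \<cdot>\<^bsub>A\<^esub> f = Zero A X (Cod A (coker_proj A f))"
  using is_cokernel_coker_proj[of f] by (simp add: is_cokernel_def homset_def)

lemma coker_proj_universal:
  assumes "f \<in> homset A X Y" "g \<in> homset A Y Z" "g \<cdot>\<^bsub>A\<^esub> f = Zero A X Z"
  shows "\<exists>!h. h \<in> homset A (Cod A (coker_proj A f)) Z \<and> h \<cdot>\<^bsub>A\<^esub> coker_proj A f = g"
  using is_cokernel_coker_proj[of f] assms homset_Ob[OF assms(2)]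
  by (simp add: is_cokernel_def homset_def)

lemma coker_proj_cancel:
  assumes f: "f \<in> homset A X Y" and h: "h \<in> homset A (Cod A (coker_proj A f)) Z"
    and k: "k \<in> homset A (Cod A (coker_proj A f)) Z"
    and eq: "h \<cdot>\<^bsub>A\<^esub> coker_proj A f = k \<cdot>\<^bsub>A\<^esub> coker_proj A f"
  shows "h = k"
proof -
  note p = coker_proj_in_homset[OF f]
  have "(k \<cdot>\<^bsub>A\<^esub> coker_proj A f) \<cdot>\<^bsub>A\<^esub> f = Zero A X Z"
    using Comp_assoc[OF f p k] coker_proj_Comp[OF f] Comp_Zero_right homset_Ob[OF f] k by simp
  from coker_proj_universal[OF f Comp_in_homset[OF p k] this] show ?thesis using h k eq by blast
qed

lemma null_object_coker:
  assumes f: "f \<in> homset A X Y" and Y: "null_object A Y"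
  shows "null_object A (Cod A (coker_proj A f))"
proof -
  let ?p = "coker_proj A f" let ?Q = "Cod A ?p"
  note p = coker_proj_in_homset[OF f]
  have Q: "?Q \<in> Ob A" using homset_Ob[OF p] by simp
  have YO: "Y \<in> Ob A" using homset_Ob[OF p] by simp
  have ini: "\<And>Z. Z \<in> Ob A \<Longrightarrow> \<exists>!f. f \<in> homset A Y Z" and ter: "\<And>Z. Z \<in> Ob A \<Longrightarrow> \<exists>!f. f \<in> homset A Z Y"
    using Y by (auto simp: null_object_def initial_object_def terminal_object_def)
  obtain q where q: "q \<in> homset A ?Q Y" using ter[OF Q] by blast
  have qp: "q \<cdot>\<^bsub>A\<^esub> ?p = Ident A Y"
    using ini[OF YO] Comp_in_homset[OF p q] Ident_in_homset[OF YO] by blast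
  have "(?p \<cdot>\<^bsub>A\<^esub> q) \<cdot>\<^bsub>A\<^esub> ?p = Ident A ?Q \<cdot>\<^bsub>A\<^esub> ?p"
    using Comp_assoc[OF p q p] qp Ident_right[OF p] Ident_left[OF p] by simp
  from coker_proj_cancel[OF f Comp_in_homset[OF q p] Ident_in_homset[OF Q] this]
  have pq: "?p \<cdot>\<^bsub>A\<^esub> q = Ident A ?Q" .
  have "\<exists>!h. h \<in> homset A ?Q Z" if Z: "Z \<in> Ob A" for Z
  proof -
    have "h = h'" if h: "h \<in> homset A ?Q Z" "h' \<in> homset A ?Q Z" for h h'
      using coker_proj_cancel[OF f h] ini[OF Z] Comp_in_homset[OF p h(1)] Comp_in_homset[OF p h(2)]
      by blast
    then show ?thesis using ini[OF Z] Comp_in_homset[OF q] by blast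
  qed
  moreover have "\<exists>!h. h \<in> homset A Z ?Q" if Z: "Z \<in> Ob A" for Z
  proof -
    have "h = ?p \<cdot>\<^bsub>A\<^esub> (q \<cdot>\<^bsub>A\<^esub> h)" if h: "h \<in> homset A Z ?Q" for h
      using Comp_assoc[OF h q p] pq Ident_left[OF h] by simp
    then have "h = h'" if "h \<in> homset A Z ?Q" "h' \<in> homset A Z ?Q" for h h'
      using that ter[OF Z] Comp_in_homset[OF that(1) q] Comp_in_homset[OF that(2) q] by metis
    moreover obtain t where "t \<in> homset A Z Y" using ter[OF Z] by blast
    then have "?p \<cdot>\<^bsub>A\<^esub> t \<in> homset A Z ?Q" using p by (rule Comp_in_homset)
    ultimately show ?thesis by blast
  qed
  ultimately show ?thesis using Q by (auto simp: null_object_def initial_object_def terminal_object_def)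
qed

end

lemma coker_fctr_on_Arr:
  assumes "abelian_category A" "natural_transformation C A F G \<tau>" "f \<in> homset C X Y"
  defines "Q \<equiv> coker_fctr C A G \<tau>"
  shows "on_Arr Q f \<in> homset A (on_Ob Q X) (on_Ob Q Y)"
    and "on_Arr Q f \<cdot>\<^bsub>A\<^esub> coker_proj A (\<tau> X) = coker_proj A (\<tau> Y) \<cdot>\<^bsub>A\<^esub> on_Arr G f"
proof -
  interpret A: abelian_category A by fact
  interpret n: natural_transformation C A F G \<tau> by fact
  note f = assms(3)
  note XY = n.F.src.homset_Ob[OF f]
  note tX = n.component_in_homset[OF XY(1)] and tY = n.component_in_homset[OF XY(2)]
  note Gf = n.G.on_Arr_in_homset[OF f] and Ff = n.F.on_Arr_in_homset[OF f]
  note pY = A.coker_proj_in_homset[OF tY]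
  have "(coker_proj A (\<tau> Y) \<cdot>\<^bsub>A\<^esub> on_Arr G f) \<cdot>\<^bsub>A\<^esub> \<tau> X = coker_proj A (\<tau> Y) \<cdot>\<^bsub>A\<^esub> (\<tau> Y \<cdot>\<^bsub>A\<^esub> on_Arr F f)"
    using A.Comp_assoc[OF tX Gf pY] n.naturality[OF f] by simp
  also have "\<dots> = Zero A (on_Ob F X) (Cod A (coker_proj A (\<tau> Y)))"
    using A.Comp_assoc[OF Ff tY pY] A.coker_proj_Comp[OF tY] A.Comp_Zero_left[OF _ Ff]
      A.homset_Ob[OF pY] by simp
  finally have ex1: "\<exists>!h. h \<in> homset A (Cod A (coker_proj A (\<tau> X))) (Cod A (coker_proj A (\<tau> Y))) \<and>
      h \<cdot>\<^bsub>A\<^esub> coker_proj A (\<tau> X) = coker_proj A (\<tau> Y) \<cdot>\<^bsub>A\<^esub> on_Arr G f"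
    by (rule A.coker_proj_universal[OF tX A.Comp_in_homset[OF Gf pY]])
  have "Dom C f = X" "Cod C f = Y" using f by (auto simp: homset_def)
  then show "on_Arr Q f \<in> homset A (on_Ob Q X) (on_Ob Q Y)"
    "on_Arr Q f \<cdot>\<^bsub>A\<^esub> coker_proj A (\<tau> X) = coker_proj A (\<tau> Y) \<cdot>\<^bsub>A\<^esub> on_Arr G f"
    using theI'[OF ex1] by (simp_all add: Q_def coker_fctr_def)
qed

lemma is_functor_coker_fctr:
  assumes "abelian_category A" "natural_transformation C A F G \<tau>"
  shows "is_functor C A (coker_fctr C A G \<tau>)"
proof -
  interpret A: abelian_category A by fact
  interpret n: natural_transformation C A F G \<tau> by fact
  let ?Q = "coker_fctr C A G \<tau>"
  let ?p = "\<lambda>X. coker_proj A (\<tau> X)"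
  have Q: "on_Ob ?Q X = Cod A (?p X)" for X by (simp add: coker_fctr_def)
  note QA = coker_fctr_on_Arr[OF assms, unfolded Q]
  have p: "?p X \<in> homset A (on_Ob G X) (Cod A (?p X))" if "X \<in> Ob C" for X
    using A.coker_proj_in_homset n.component_in_homset that by blast
  show ?thesis
  proof unfold_locales
    fix X assume X: "X \<in> Ob C"
    show QX: "on_Ob ?Q X \<in> Ob A" using A.homset_Ob[OF p[OF X]] Q by simp
    note i = n.F.src.Ident_in_homset[OF X]
    show "on_Arr ?Q (Ident C X) = Ident A (on_Ob ?Q X)"
      unfolding Q
      using A.coker_proj_cancel[OF n.component_in_homset[OF X] QA(1)[OF i]
        A.Ident_in_homset[OF QX[unfolded Q]]] QA(2)[OF i] n.G.on_Arr_Ident[OF X]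
        A.Ident_left[OF p[OF X]] A.Ident_right[OF p[OF X]] by simp
  next
    fix f X Y assume "f \<in> homset C X Y"
    then show "on_Arr ?Q f \<in> homset A (on_Ob ?Q X) (on_Ob ?Q Y)" using QA(1) Q by simp
  next
    fix f X Y g Z assume f: "f \<in> homset C X Y" and g: "g \<in> homset C Y Z"
    note X = n.F.src.homset_Ob(1)[OF f] and Y = n.F.src.homset_Ob(2)[OF f]
      and Z = n.F.src.homset_Ob(2)[OF g]
    note gf = n.F.src.Comp_in_homset[OF f g]
    note Gf = n.G.on_Arr_in_homset[OF f] and Gg = n.G.on_Arr_in_homset[OF g]
    have "(on_Arr ?Q g \<cdot>\<^bsub>A\<^esub> on_Arr ?Q f) \<cdot>\<^bsub>A\<^esub> ?p X = on_Arr ?Q g \<cdot>\<^bsub>A\<^esub> (?p Y \<cdot>\<^bsub>A\<^esub> on_Arr G f)"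
      using A.Comp_assoc[OF p[OF X] QA(1)[OF f] QA(1)[OF g]] QA(2)[OF f] by simp
    also have "\<dots> = (?p Z \<cdot>\<^bsub>A\<^esub> on_Arr G g) \<cdot>\<^bsub>A\<^esub> on_Arr G f"
      using A.Comp_assoc[OF Gf p[OF Y] QA(1)[OF g]] QA(2)[OF g] by simp
    also have "\<dots> = on_Arr ?Q (g \<cdot>\<^bsub>C\<^esub> f) \<cdot>\<^bsub>A\<^esub> ?p X"
      using A.Comp_assoc[OF Gf Gg p[OF Z]] QA(2)[OF gf] n.G.on_Arr_Comp[OF f g] by simp
    finally show "on_Arr ?Q (g \<cdot>\<^bsub>C\<^esub> f) = on_Arr ?Q g \<cdot>\<^bsub>A\<^esub> on_Arr ?Q f"
      using A.coker_proj_cancel[OF n.component_in_homset[OF X] QA(1)[OF gf]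
        A.Comp_in_homset[OF QA(1)[OF f] QA(1)[OF g]]] by simp
  qed
qed

lemma degree_lt_Suc:
  assumes A: "abelian_category A"
    and s: "\<And>i. i \<in> I \<Longrightarrow> natural_transformation C C id_fctr (s i) (\<iota> i)"
    and T: "is_functor C A T" and "degree_lt C A I s \<iota> n T"
  shows "degree_lt C A I s \<iota> (Suc n) T"
  using T assms(4)
proof (induction n arbitrary: T)
  case 0
  have "null_object A (Cod A (coker_proj A (on_Arr T (\<iota> i c))))" if "i \<in> I" "c \<in> Ob C" for i c
  proof -
    interpret n: natural_transformation C C id_fctr "s i" "\<iota> i" using s that by blast
    interpret w: natural_transformation C A T "comp_fctr T (s i)" "\<lambda>c. on_Arr T (\<iota> i c)"
      using natural_transformation_whisker[OF s[OF that(1)] 0(1)] .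
    show ?thesis
      using abelian_category.null_object_coker[OF A w.component_in_homset[OF that(2)]]
        0(2) n.G.on_Ob_in_Ob[OF that(2)] by (simp add: zero_fctr_def comp_fctr_def)
  qed
  then show ?case by (simp add: zero_fctr_def coker_fctr_def)
next
  case (Suc n)
  let ?Q = "\<lambda>i. coker_fctr C A (comp_fctr T (s i)) (\<lambda>c. on_Arr T (\<iota> i c))"
  have "degree_lt C A I s \<iota> (Suc n) (?Q i)" if i: "i \<in> I" for i
  proof (rule Suc.IH)
    show "is_functor C A (?Q i)"
      by (rule is_functor_coker_fctr[OF A natural_transformation_whisker[OF s[OF i] Suc.prems(1)]])
    show "degree_lt C A I s \<iota> n (?Q i)" using Suc.prems(2) i by simp
  qed
  then show ?case by (subst degree_lt.simps(2)) blast
qed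

lemma degree_le_iff:
  assumes A: "abelian_category A"
    and s: "\<And>i. i \<in> I \<Longrightarrow> natural_transformation C C id_fctr (s i) (\<iota> i)"
    and T: "is_functor C A T"
  shows "degree C A I s \<iota> T \<le> ereal (real n - 1) \<longleftrightarrow> degree_lt C A I s \<iota> n T"
proof
  let ?P = "\<lambda>n. degree_lt C A I s \<iota> n T"
  assume "degree C A I s \<iota> T \<le> ereal (real n - 1)"
  then have "degree C A I s \<iota> T < ereal (real n)"
    by (rule le_less_trans) simp
  then obtain m where m: "?P m" "real m - 1 < real n"
    unfolding degree_def Inf_less_iff by auto
  then have "m \<le> n" by linarith
  then show "?P n"
  proof (induction rule: dec_induct)
    case base
    show ?case by (rule m(1))
  next
    case (step k)
    show ?case by (rule degree_lt_Suc[OF A s T step.IH])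
  qed
next
  assume "degree_lt C A I s \<iota> n T"
  then show "degree C A I s \<iota> T \<le> ereal (real n - 1)"
    unfolding degree_def by (intro Inf_lower) blast
qed

lemma stab_natural:
  assumes m: "strict_left_module M C act" and I: "initial_object M (Unit M)" and y: "y \<in> Ob M"
  shows "natural_transformation C C id_fctr (stab M act y) (stab_trans M C act y)"
proof -
  interpret m: strict_left_module M C act by fact
  have h: "(u, f) \<in> homset (prod_cat M C) (a, b) (c, d) \<longleftrightarrow> u \<in> homset M a c \<and> f \<in> homset C b d" for u f a b c d
    by (auto simp: homset_def prod_cat_def)
  note funct = m.action.on_Arr_in_homset[OF iffD2[OF h], simplified]
  have comp: "on_Arr act (v, g) \<cdot>\<^bsub>C\<^esub> on_Arr act (u, f) = on_Arr act (v \<cdot>\<^bsub>M\<^esub> u, g \<cdot>\<^bsub>C\<^esub> f)"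
    if "u \<in> homset M a b" "v \<in> homset M b c" "f \<in> homset C a' b'" "g \<in> homset C b' c'" for u v f g a b c a' b' c'
    using m.action.on_Arr_Comp[of "(u,f)" "(a,a')" "(b,b')" "(v,g)" "(c,c')"] that
    by (simp add: h) (simp add: prod_cat_def)
  have i: "from_Unit M y \<in> homset M (Unit M) y"
    using theI'[of "\<lambda>f. f \<in> homset M (Unit M) y"] I y
    unfolding from_Unit_def initial_object_def by blast
  note idy = m.Ident_in_homset[OF y] and idI = m.Ident_in_homset[OF m.Unit_in_Ob]
  interpret i: is_functor C C id_fctr by unfold_locales (auto simp: id_fctr_def)
  interpret s: is_functor C C "stab M act y"
  proof unfold_locales
    fix X assume "X \<in> Ob C"
    then show "on_Ob (stab M act y) X \<in> Ob C"
      "on_Arr (stab M act y) (Ident C X) = Ident C (on_Ob (stab M act y) X)"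
      using m.action.on_Ob_in_Ob[of "(y,X)"] m.action.on_Arr_Ident[of "(y,X)"] y
      by (auto simp: stab_def prod_cat_def)
  next
    fix f X Y assume "f \<in> homset C X Y"
    then show "on_Arr (stab M act y) f \<in> homset C (on_Ob (stab M act y) X) (on_Ob (stab M act y) Y)"
      using funct idy by (simp add: stab_def)
  next
    fix f X Y g Z assume "f \<in> homset C X Y" "g \<in> homset C Y Z"
    then show "on_Arr (stab M act y) (g \<cdot>\<^bsub>C\<^esub> f) = on_Arr (stab M act y) g \<cdot>\<^bsub>C\<^esub> on_Arr (stab M act y) f"
      using comp[OF idy idy] m.Ident_left[OF idy] by (simp add: stab_def)
  qed
  show ?thesis
  proof unfold_locales
    fix X assume X: "X \<in> Ob C"
    then show "stab_trans M C act y X \<in> homset C (on_Ob id_fctr X) (on_Ob (stab M act y) X)"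
      using funct[of "from_Unit M y" "Unit M" y "Ident C X" X X] i m.module.Ident_in_homset[OF X]
        m.act_Unit_Ob[OF X] by (simp add: id_fctr_def stab_def stab_trans_def)
  next
    fix f X Y assume f: "f \<in> homset C X Y"
    note XY = m.module.homset_Ob[OF f]
    have fA: "f = on_Arr act (Ident M (Unit M), f)" using m.act_Unit_Arr f by (simp add: homset_def)
    have "on_Arr act (from_Unit M y, Ident C Y) \<cdot>\<^bsub>C\<^esub> f = on_Arr act (from_Unit M y, f)"
      using comp[OF idI i f m.module.Ident_in_homset[OF XY(2)]] fA
        m.Ident_right[OF i] m.module.Ident_left[OF f] by simp
    also have "\<dots> = on_Arr act (Ident M y, f) \<cdot>\<^bsub>C\<^esub> on_Arr act (from_Unit M y, Ident C X)"
      using comp[OF i idy m.module.Ident_in_homset[OF XY(1)] f]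
        m.Ident_left[OF i] m.module.Ident_right[OF f] by simp
    finally show "stab_trans M C act y Y \<cdot>\<^bsub>C\<^esub> on_Arr id_fctr f = on_Arr (stab M act y) f \<cdot>\<^bsub>C\<^esub> stab_trans M C act y X"
      by (simp add: id_fctr_def stab_def stab_trans_def)
  qed
qed

end

theory Submission
  imports Defs
begin

text \<open>
  For an endofunctor \<open>S\<close> with a natural transformation \<open>id \<rightarrow> S\<close> write \<open>\<Delta>\<^sub>S T\<close> for the cokernel
  of \<open>T \<rightarrow> T S\<close>. Since \<open>\<Delta>\<^sub>S\<close> is right exact, the middle term of a right exact sequence
  \<open>F \<rightarrow> G \<rightarrow> H \<rightarrow> 0\<close> has degree at most \<open>d\<close> if the outer terms do. If \<open>\<Delta>\<^sub>S\<close> lowers the degree, then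
  \<open>T \<rightarrow> T S \<rightarrow> \<Delta>\<^sub>S T \<rightarrow> 0\<close> shows that precomposition with \<open>S\<close> does not raise it. The factorisation
  \<open>T \<rightarrow> T S \<rightarrow> T S S'\<close> yields a right exact sequence
  \<open>\<Delta>\<^sub>S T \<rightarrow> \<Delta>\<^bsub>S S'\<^esub> T \<rightarrow> \<Delta>\<^bsub>S'\<^esub> (T S) \<rightarrow> 0\<close>, so the endofunctors \<open>S\<close> for which \<open>\<Delta>\<^sub>S\<close> lowers the
  degree with respect to \<open>x\<close> are closed under composition. They contain \<open>s\<^sub>x\<close>, hence \<open>s\<^sub>y\<close> for every
  \<open>y\<close> isomorphic to a power of \<open>x\<close>.
\<close>

section \<open>Epimorphisms and isomorphisms\<close>

context category
begin

lemma epicI: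
  assumes "f \<in> homset C X Y"
    and "\<And>Z g h. g \<in> homset C Y Z \<Longrightarrow> h \<in> homset C Y Z \<Longrightarrow> g \<cdot>\<^bsub>C\<^esub> f = h \<cdot>\<^bsub>C\<^esub> f \<Longrightarrow> g = h"
  shows "epic C f"
  using assms by (auto simp: epic_def homset_def)

lemma epicD:
  assumes "epic C f" "f \<in> homset C X Y" "g \<in> homset C Y Z" "h \<in> homset C Y Z"
    and "g \<cdot>\<^bsub>C\<^esub> f = h \<cdot>\<^bsub>C\<^esub> f"
  shows "g = h"
  using assms by (auto simp: epic_def homset_def)

lemma epic_Ident:
  assumes "X \<in> Ob C"
  shows "epic C (Ident C X)"
  using Ident_in_homset[OF assms] by (rule epicI) (simp add: Ident_right)

lemma epic_Comp:
  assumes f: "f \<in> homset C X Y" "epic C f" and g: "g \<in> homset C Y Z" "epic C g"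
  shows "epic C (g \<cdot>\<^bsub>C\<^esub> f)"
proof (rule epicI[OF Comp_in_homset[OF f(1) g(1)]])
  fix W h k
  assume h: "h \<in> homset C Z W" and k: "k \<in> homset C Z W"
    and eq: "h \<cdot>\<^bsub>C\<^esub> (g \<cdot>\<^bsub>C\<^esub> f) = k \<cdot>\<^bsub>C\<^esub> (g \<cdot>\<^bsub>C\<^esub> f)"
  have "(h \<cdot>\<^bsub>C\<^esub> g) \<cdot>\<^bsub>C\<^esub> f = (k \<cdot>\<^bsub>C\<^esub> g) \<cdot>\<^bsub>C\<^esub> f"
    using eq Comp_assoc[OF f(1) g(1) h] Comp_assoc[OF f(1) g(1) k] by simp
  then have "h \<cdot>\<^bsub>C\<^esub> g = k \<cdot>\<^bsub>C\<^esub> g"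
    by (rule epicD[OF f(2,1) Comp_in_homset[OF g(1) h] Comp_in_homset[OF g(1) k]])
  then show "h = k"
    by (rule epicD[OF g(2,1) h k])
qed

lemma epic_left_factor:
  assumes f: "f \<in> homset C X Y" and g: "g \<in> homset C Y Z" and gf: "epic C (g \<cdot>\<^bsub>C\<^esub> f)"
  shows "epic C g"
proof (rule epicI[OF g])
  fix W h k
  assume h: "h \<in> homset C Z W" and k: "k \<in> homset C Z W" and "h \<cdot>\<^bsub>C\<^esub> g = k \<cdot>\<^bsub>C\<^esub> g"
  then have "h \<cdot>\<^bsub>C\<^esub> (g \<cdot>\<^bsub>C\<^esub> f) = k \<cdot>\<^bsub>C\<^esub> (g \<cdot>\<^bsub>C\<^esub> f)"
    using Comp_assoc[OF f g h] Comp_assoc[OF f g k] by simp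
  then show "h = k"
    by (rule epicD[OF gf Comp_in_homset[OF f g] h k])
qed

lemma isomorphismI:
  assumes "f \<in> homset C X Y" "g \<in> homset C Y X"
    and "g \<cdot>\<^bsub>C\<^esub> f = Ident C X" "f \<cdot>\<^bsub>C\<^esub> g = Ident C Y"
  shows "isomorphism C f"
  using assms by (auto simp: isomorphism_def homset_def)

lemma isomorphismE:
  assumes "isomorphism C f" "f \<in> homset C X Y"
  obtains g where "g \<in> homset C Y X" "g \<cdot>\<^bsub>C\<^esub> f = Ident C X" "f \<cdot>\<^bsub>C\<^esub> g = Ident C Y"
  using assms by (auto simp: isomorphism_def homset_def)

lemma isomorphism_epic:
  assumes f: "isomorphism C f" "f \<in> homset C X Y"
  shows "epic C f"
proof -
  obtain g where g: "g \<in> homset C Y X" and "f \<cdot>\<^bsub>C\<^esub> g = Ident C Y"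
    by (rule isomorphismE[OF f])
  then show ?thesis
    using epic_left_factor[OF g f(2)] epic_Ident[OF homset_Ob(2)[OF f(2)]] by simp
qed

lemma isomorphism_Ident:
  assumes "X \<in> Ob C"
  shows "isomorphism C (Ident C X)"
proof -
  note id_X = Ident_in_homset[OF assms]
  show ?thesis by (rule isomorphismI[OF id_X id_X Ident_left[OF id_X] Ident_left[OF id_X]])
qed

lemma isomorphic_sym:
  assumes "isomorphic C X Y"
  shows "isomorphic C Y X"
proof -
  obtain f where f: "f \<in> homset C X Y" "isomorphism C f"
    using assms unfolding isomorphic_def by blast
  obtain g where g: "g \<in> homset C Y X"
    and "g \<cdot>\<^bsub>C\<^esub> f = Ident C X" "f \<cdot>\<^bsub>C\<^esub> g = Ident C Y"
    by (rule isomorphismE[OF f(2,1)])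
  then have "isomorphism C g" using isomorphismI[OF g f(1)] by simp
  then show ?thesis using g unfolding isomorphic_def by blast
qed

end

lemma (in is_functor) isomorphism_on_Arr:
  assumes f: "isomorphism C f" "f \<in> homset C X Y"
  shows "isomorphism D (on_Arr F f)"
proof -
  note XY = src.homset_Ob[OF f(2)]
  obtain g where g: "g \<in> homset C Y X"
    and gf: "g \<cdot>\<^bsub>C\<^esub> f = Ident C X" and fg: "f \<cdot>\<^bsub>C\<^esub> g = Ident C Y"
    by (rule src.isomorphismE[OF f])
  show ?thesis
  proof (rule tgt.isomorphismI[OF on_Arr_in_homset[OF f(2)] on_Arr_in_homset[OF g]])
    show "on_Arr F g \<cdot>\<^bsub>D\<^esub> on_Arr F f = Ident D (on_Ob F X)"
      using on_Arr_Comp[OF f(2) g] on_Arr_Ident[OF XY(1)] gf by simp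
    show "on_Arr F f \<cdot>\<^bsub>D\<^esub> on_Arr F g = Ident D (on_Ob F Y)"
      using on_Arr_Comp[OF g f(2)] on_Arr_Ident[OF XY(2)] fg by simp
  qed
qed

section \<open>Right exact sequences in abelian categories\<close>

definition right_exact ::
  "('o, 'a, 'z) ab_cat_scheme \<Rightarrow> 'o \<Rightarrow> 'a \<Rightarrow> 'o \<Rightarrow> 'a \<Rightarrow> 'o \<Rightarrow> bool" where
  "right_exact A X f Y p Q \<longleftrightarrow> f \<in> homset A X Y \<and> p \<in> homset A Y Q \<and> is_cokernel A f p"

lemma right_exactD:
  assumes "right_exact A X f Y p Q"
  shows "f \<in> homset A X Y" "p \<in> homset A Y Q" "p \<cdot>\<^bsub>A\<^esub> f = Zero A X Q"
  using assms by (simp_all add: right_exact_def is_cokernel_def homset_def)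

context abelian_category
begin

lemma eq_Zero_if_Comp_epic:
  assumes e: "e \<in> homset A X Y" "epic A e" and h: "h \<in> homset A Y Z"
    and he: "h \<cdot>\<^bsub>A\<^esub> e = Zero A X Z"
  shows "h = Zero A Y Z"
  using epicD[OF e(2,1) h Zero_in_homset[OF homset_Ob[OF h]]]
    Comp_Zero_left[OF homset_Ob(2)[OF h] e(1)] he by simp

lemma right_exact_iff:
  "right_exact A X f Y p Q \<longleftrightarrow>
    f \<in> homset A X Y \<and> p \<in> homset A Y Q \<and> p \<cdot>\<^bsub>A\<^esub> f = Zero A X Q \<and>
    (\<forall>Z. \<forall>g \<in> homset A Y Z. g \<cdot>\<^bsub>A\<^esub> f = Zero A X Z \<longrightarrow>
      (\<exists>!h. h \<in> homset A Q Z \<and> h \<cdot>\<^bsub>A\<^esub> p = g))"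
proof (cases "f \<in> homset A X Y \<and> p \<in> homset A Y Q")
  case True
  then have "f \<in> Arr A" "Dom A f = X" "Cod A f = Y" "p \<in> Arr A" "Dom A p = Y" "Cod A p = Q"
    by (simp_all add: homset_def)
  moreover have "Z \<in> Ob A" if "g \<in> homset A Y Z" for g Z
    by (rule homset_Ob(2)[OF that])
  ultimately show ?thesis
    using True unfolding right_exact_def is_cokernel_def by simp meson
qed (auto simp: right_exact_def)

lemma right_exact_factor:
  assumes "right_exact A X f Y p Q" "g \<in> homset A Y Z" "g \<cdot>\<^bsub>A\<^esub> f = Zero A X Z"
  obtains h where "h \<in> homset A Q Z" "h \<cdot>\<^bsub>A\<^esub> p = g"
  using assms unfolding right_exact_iff by blast

lemma right_exact_epic:
  assumes r: "right_exact A X f Y p Q"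
  shows "epic A p"
proof (rule epicI)
  note f = right_exactD(1)[OF r] and p = right_exactD(2)[OF r]
  show "p \<in> homset A Y Q" by (fact p)
  fix Z g h
  assume g: "g \<in> homset A Q Z" and h: "h \<in> homset A Q Z" and eq: "g \<cdot>\<^bsub>A\<^esub> p = h \<cdot>\<^bsub>A\<^esub> p"
  have "(h \<cdot>\<^bsub>A\<^esub> p) \<cdot>\<^bsub>A\<^esub> f = Zero A X Z"
    using Comp_assoc[OF f p h] right_exactD(3)[OF r] Comp_Zero_right[OF homset_Ob(1)[OF f] h]
    by simp
  then show "g = h"
    using r Comp_in_homset[OF p h] g h eq unfolding right_exact_iff by blast
qed

lemma right_exactI:
  assumes f: "f \<in> homset A X Y" and p: "p \<in> homset A Y Q" "epic A p"
    and pf: "p \<cdot>\<^bsub>A\<^esub> f = Zero A X Q"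
    and factor: "\<And>Z g. g \<in> homset A Y Z \<Longrightarrow> g \<cdot>\<^bsub>A\<^esub> f = Zero A X Z \<Longrightarrow>
      \<exists>h \<in> homset A Q Z. h \<cdot>\<^bsub>A\<^esub> p = g"
  shows "right_exact A X f Y p Q"
  unfolding right_exact_iff
proof (intro conjI allI ballI impI f p(1) pf)
  fix Z g
  assume "g \<in> homset A Y Z" "g \<cdot>\<^bsub>A\<^esub> f = Zero A X Z"
  then show "\<exists>!h. h \<in> homset A Q Z \<and> h \<cdot>\<^bsub>A\<^esub> p = g"
    using factor epicD[OF p(2,1)] by metis
qed

lemma right_exact_coker_proj:
  assumes f: "f \<in> homset A X Y"
  shows "right_exact A X f Y (coker_proj A f) (Cod A (coker_proj A f))"
proof -
  have "f \<in> Arr A" using f by (simp add: homset_def)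
  then show ?thesis
    using f coker_proj_in_homset[OF f] is_cokernel_coker_proj by (simp add: right_exact_def)
qed

lemma right_exact_Zero_Ident:
  assumes X: "X \<in> Ob A" and Y: "Y \<in> Ob A"
  shows "right_exact A X (Zero A X Y) Y (Ident A Y) Y"
proof (rule right_exactI[OF Zero_in_homset[OF X Y] Ident_in_homset[OF Y] epic_Ident[OF Y]])
  show "Ident A Y \<cdot>\<^bsub>A\<^esub> Zero A X Y = Zero A X Y"
    by (rule Ident_left[OF Zero_in_homset[OF X Y]])
  show "\<exists>h \<in> homset A Y Z. h \<cdot>\<^bsub>A\<^esub> Ident A Y = g" if "g \<in> homset A Y Z" for Z g
    using that Ident_right by blast
qed

lemma cokernel_map:
  assumes r: "right_exact A X f Y p Q" and r': "right_exact A X' f' Y' p' Q'"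
    and u: "u \<in> homset A X X'" and v: "v \<in> homset A Y Y'" and square: "v \<cdot>\<^bsub>A\<^esub> f = f' \<cdot>\<^bsub>A\<^esub> u"
  obtains h where "h \<in> homset A Q Q'" "h \<cdot>\<^bsub>A\<^esub> p = p' \<cdot>\<^bsub>A\<^esub> v"
proof (rule right_exact_factor[OF r])
  note f = right_exactD(1)[OF r] and f' = right_exactD(1)[OF r'] and p' = right_exactD(2)[OF r']
  show "p' \<cdot>\<^bsub>A\<^esub> v \<in> homset A Y Q'" by (rule Comp_in_homset[OF v p'])
  have "(p' \<cdot>\<^bsub>A\<^esub> v) \<cdot>\<^bsub>A\<^esub> f = (p' \<cdot>\<^bsub>A\<^esub> f') \<cdot>\<^bsub>A\<^esub> u"
    using Comp_assoc[OF f v p'] Comp_assoc[OF u f' p'] square by simp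
  then show "(p' \<cdot>\<^bsub>A\<^esub> v) \<cdot>\<^bsub>A\<^esub> f = Zero A X Q'"
    using right_exactD(3)[OF r'] Comp_Zero_left[OF homset_Ob(2)[OF p'] u] by simp
qed

lemma cokernel_map_factor:
  assumes r: "right_exact A X f Y p Q" and r': "right_exact A X' f' Y' p' Q'"
    and u: "u \<in> homset A X X'" "epic A u" and v: "v \<in> homset A Y Y'"
    and square: "v \<cdot>\<^bsub>A\<^esub> f = f' \<cdot>\<^bsub>A\<^esub> u"
    and h: "h \<in> homset A Q Q'" "h \<cdot>\<^bsub>A\<^esub> p = p' \<cdot>\<^bsub>A\<^esub> v"
    and g: "g \<in> homset A Q Z" and k: "k \<in> homset A Y' Z" "k \<cdot>\<^bsub>A\<^esub> v = g \<cdot>\<^bsub>A\<^esub> p"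
  obtains l where "l \<in> homset A Q' Z" "l \<cdot>\<^bsub>A\<^esub> h = g"
proof -
  note f = right_exactD(1)[OF r] and p = right_exactD(2)[OF r]
    and f' = right_exactD(1)[OF r'] and p' = right_exactD(2)[OF r']
  have "(k \<cdot>\<^bsub>A\<^esub> f') \<cdot>\<^bsub>A\<^esub> u = g \<cdot>\<^bsub>A\<^esub> (p \<cdot>\<^bsub>A\<^esub> f)"
    using Comp_assoc[OF u(1) f' k(1)] Comp_assoc[OF f v k(1)] Comp_assoc[OF f p g] square k(2)
    by simp
  also have "\<dots> = Zero A X Z"
    using right_exactD(3)[OF r] Comp_Zero_right[OF homset_Ob(1)[OF f] g] by simp
  finally have "k \<cdot>\<^bsub>A\<^esub> f' = Zero A X' Z"
    by (rule eq_Zero_if_Comp_epic[OF u Comp_in_homset[OF f' k(1)]])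
  then obtain l where l: "l \<in> homset A Q' Z" "l \<cdot>\<^bsub>A\<^esub> p' = k"
    by (rule right_exact_factor[OF r' k(1)])
  have "(l \<cdot>\<^bsub>A\<^esub> h) \<cdot>\<^bsub>A\<^esub> p = g \<cdot>\<^bsub>A\<^esub> p"
    using Comp_assoc[OF p h(1) l(1)] Comp_assoc[OF v p' l(1)] h(2) l(2) k(2) by simp
  then have "l \<cdot>\<^bsub>A\<^esub> h = g"
    by (rule epicD[OF right_exact_epic[OF r] p Comp_in_homset[OF h(1) l(1)] g])
  with l(1) show ?thesis by (rule that)
qed

text \<open>
  The cokernels \<open>Q\<^sub>i\<close> of the rows \<open>X\<^sub>i \<rightarrow> Y\<^sub>i\<close> inherit right exactness from the column of the \<open>Y\<^sub>i\<close>;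
  of the column of the \<open>X\<^sub>i\<close> only the epimorphism \<open>X\<^sub>2 \<rightarrow> X\<^sub>3\<close> matters.
\<close>

lemma right_exact_cokernels:
  assumes r1: "right_exact A X1 f1 Y1 p1 Q1"
    and r2: "right_exact A X2 f2 Y2 p2 Q2"
    and r3: "right_exact A X3 f3 Y3 p3 Q3"
    and x: "x \<in> homset A X2 X3" "epic A x"
    and ry: "right_exact A Y1 y Y2 y' Y3"
    and q: "q \<in> homset A Q1 Q2" and q': "q' \<in> homset A Q2 Q3"
    and square: "y' \<cdot>\<^bsub>A\<^esub> f2 = f3 \<cdot>\<^bsub>A\<^esub> x"
    and qp: "q \<cdot>\<^bsub>A\<^esub> p1 = p2 \<cdot>\<^bsub>A\<^esub> y" and q'p: "q' \<cdot>\<^bsub>A\<^esub> p2 = p3 \<cdot>\<^bsub>A\<^esub> y'"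
  shows "right_exact A Q1 q Q2 q' Q3"
proof (rule right_exactI[OF q q'])
  note p1 = right_exactD(2)[OF r1] and p2 = right_exactD(2)[OF r2] and p3 = right_exactD(2)[OF r3]
    and y = right_exactD(1)[OF ry] and y' = right_exactD(2)[OF ry]
  have "epic A (q' \<cdot>\<^bsub>A\<^esub> p2)"
    unfolding q'p by (rule epic_Comp[OF y' right_exact_epic[OF ry] p3 right_exact_epic[OF r3]])
  then show "epic A q'" by (rule epic_left_factor[OF p2 q'])
  have "(q' \<cdot>\<^bsub>A\<^esub> q) \<cdot>\<^bsub>A\<^esub> p1 = p3 \<cdot>\<^bsub>A\<^esub> (y' \<cdot>\<^bsub>A\<^esub> y)"
    using Comp_assoc[OF p1 q q'] Comp_assoc[OF y p2 q'] Comp_assoc[OF y y' p3] qp q'p by simp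
  also have "\<dots> = Zero A Y1 Q3"
    using right_exactD(3)[OF ry] Comp_Zero_right[OF homset_Ob(1)[OF y] p3] by simp
  finally show "q' \<cdot>\<^bsub>A\<^esub> q = Zero A Q1 Q3"
    by (rule eq_Zero_if_Comp_epic[OF p1 right_exact_epic[OF r1] Comp_in_homset[OF q q']])
  fix Z g
  assume g: "g \<in> homset A Q2 Z" and gq: "g \<cdot>\<^bsub>A\<^esub> q = Zero A Q1 Z"
  have "(g \<cdot>\<^bsub>A\<^esub> p2) \<cdot>\<^bsub>A\<^esub> y = Zero A Y1 Z"
    using Comp_assoc[OF y p2 g] Comp_assoc[OF p1 q g] qp gq Comp_Zero_left[OF homset_Ob(2)[OF g] p1]
    by simp
  then obtain k where k: "k \<in> homset A Y3 Z" "k \<cdot>\<^bsub>A\<^esub> y' = g \<cdot>\<^bsub>A\<^esub> p2"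
    by (rule right_exact_factor[OF ry Comp_in_homset[OF p2 g]])
  then show "\<exists>l \<in> homset A Q3 Z. l \<cdot>\<^bsub>A\<^esub> q' = g"
    using cokernel_map_factor[OF r2 r3 x y' square q' q'p g] by blast
qed

lemma null_object_iff_Ident_eq_Zero:
  assumes X: "X \<in> Ob A"
  shows "null_object A X \<longleftrightarrow> Ident A X = Zero A X X"
proof
  assume "null_object A X"
  then show "Ident A X = Zero A X X"
    using X Ident_in_homset[OF X] Zero_in_homset[OF X X]
    by (auto simp: null_object_def initial_object_def)
next
  assume eq: "Ident A X = Zero A X X"
  have "f = Zero A X Z" if "f \<in> homset A X Z" for f Z
    using Ident_right[OF that] Comp_Zero_right[OF X that] eq by simp
  then have "\<exists>!f. f \<in> homset A X Z" if "Z \<in> Ob A" for Z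
    using Zero_in_homset[OF X that] by blast
  moreover have "f = Zero A Z X" if "f \<in> homset A Z X" for f Z
    using Ident_left[OF that] Comp_Zero_left[OF X that] eq by simp
  then have "\<exists>!f. f \<in> homset A Z X" if "Z \<in> Ob A" for Z
    using Zero_in_homset[OF that X] by blast
  ultimately show "null_object A X"
    using X by (simp add: null_object_def initial_object_def terminal_object_def)
qed

lemma right_exact_null_middle:
  assumes r: "right_exact A X f Y p Q" and X: "null_object A X" and Q: "null_object A Q"
  shows "null_object A Y"
proof -
  note f = right_exactD(1)[OF r] and p = right_exactD(2)[OF r]
  note XY = homset_Ob[OF f] and Q_Ob = homset_Ob(2)[OF p]
  have "Ident A Y \<cdot>\<^bsub>A\<^esub> f = f" by (rule Ident_left[OF f])
  also have "f = Zero A X Y"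
    using f Zero_in_homset[OF XY] X XY(2) by (auto simp: null_object_def initial_object_def)
  finally obtain h where h: "h \<in> homset A Q Y" "h \<cdot>\<^bsub>A\<^esub> p = Ident A Y"
    by (rule right_exact_factor[OF r Ident_in_homset[OF XY(2)]])
  have "p = Zero A Y Q"
    using p Zero_in_homset[OF XY(2) Q_Ob] Q XY(2) by (auto simp: null_object_def terminal_object_def)
  then have "Ident A Y = Zero A Y Y"
    using h Comp_Zero_right[OF XY(2) h(1)] by simp
  then show ?thesis by (simp add: null_object_iff_Ident_eq_Zero[OF XY(2)])
qed

lemma right_exact_null_right:
  assumes r: "right_exact A X f Y p Q" and "epic A f"
  shows "null_object A Q"
proof -
  note f = right_exactD(1)[OF r] and p = right_exactD(2)[OF r]
  note Q = homset_Ob(2)[OF p]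
  have "p = Zero A Y Q"
    by (rule eq_Zero_if_Comp_epic[OF f \<open>epic A f\<close> p right_exactD(3)[OF r]])
  then have "Ident A Q \<cdot>\<^bsub>A\<^esub> p = Zero A Y Q"
    using Ident_left[OF p] by simp
  then have "Ident A Q = Zero A Q Q"
    by (rule eq_Zero_if_Comp_epic[OF p right_exact_epic[OF r] Ident_in_homset[OF Q]])
  then show ?thesis by (simp add: null_object_iff_Ident_eq_Zero[OF Q])
qed

end

section \<open>Natural transformations\<close>

lemma comp_fctr_assoc: "comp_fctr (comp_fctr H G) F = comp_fctr H (comp_fctr G F)"
  by (simp add: comp_fctr_def comp_assoc)

lemma natural_transformation_Ident:
  assumes "is_functor C D F"
  shows "natural_transformation C D F F (\<lambda>c. Ident D (on_Ob F c))"
proof -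
  interpret is_functor C D F by fact
  show ?thesis
    using on_Ob_in_Ob tgt.Ident_in_homset tgt.Ident_left tgt.Ident_right on_Arr_in_homset
    by unfold_locales (auto, metis)
qed

lemma natural_transformation_Comp:
  assumes "natural_transformation C D F G \<sigma>" "natural_transformation C D G H \<tau>"
  shows "natural_transformation C D F H (\<lambda>c. \<tau> c \<cdot>\<^bsub>D\<^esub> \<sigma> c)"
proof -
  interpret \<sigma>: natural_transformation C D F G \<sigma> by fact
  interpret \<tau>: natural_transformation C D G H \<tau> by fact
  show ?thesis
  proof unfold_locales
    fix X assume "X \<in> Ob C"
    then show "\<tau> X \<cdot>\<^bsub>D\<^esub> \<sigma> X \<in> homset D (on_Ob F X) (on_Ob H X)"
      using \<sigma>.F.tgt.Comp_in_homset \<sigma>.component_in_homset \<tau>.component_in_homset by blast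
  next
    fix f X Y assume f: "f \<in> homset C X Y"
    note XY = \<sigma>.F.src.homset_Ob[OF f]
    note \<sigma>XY = XY[THEN \<sigma>.component_in_homset] and \<tau>XY = XY[THEN \<tau>.component_in_homset]
    note Ff = \<sigma>.F.on_Arr_in_homset[OF f] and Gf = \<sigma>.G.on_Arr_in_homset[OF f]
      and Hf = \<tau>.G.on_Arr_in_homset[OF f]
    note assoc = \<sigma>.F.tgt.Comp_assoc
    have "(\<tau> Y \<cdot>\<^bsub>D\<^esub> \<sigma> Y) \<cdot>\<^bsub>D\<^esub> on_Arr F f = (\<tau> Y \<cdot>\<^bsub>D\<^esub> on_Arr G f) \<cdot>\<^bsub>D\<^esub> \<sigma> X"
      using assoc[OF Ff \<sigma>XY(2) \<tau>XY(2)] assoc[OF \<sigma>XY(1) Gf \<tau>XY(2)] \<sigma>.naturality[OF f] by simp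
    also have "\<dots> = on_Arr H f \<cdot>\<^bsub>D\<^esub> (\<tau> X \<cdot>\<^bsub>D\<^esub> \<sigma> X)"
      using assoc[OF \<sigma>XY(1) \<tau>XY(1) Hf] \<tau>.naturality[OF f] by simp
    finally show "(\<tau> Y \<cdot>\<^bsub>D\<^esub> \<sigma> Y) \<cdot>\<^bsub>D\<^esub> on_Arr F f = on_Arr H f \<cdot>\<^bsub>D\<^esub> (\<tau> X \<cdot>\<^bsub>D\<^esub> \<sigma> X)" .
  qed
qed

lemma natural_transformation_if_Comp_epic:
  assumes \<pi>: "natural_transformation C D G Q \<pi>" "\<And>c. c \<in> Ob C \<Longrightarrow> epic D (\<pi> c)"
    and \<xi>: "natural_transformation C D G Q' \<xi>"
    and \<theta>: "\<And>c. c \<in> Ob C \<Longrightarrow> \<theta> c \<in> homset D (on_Ob Q c) (on_Ob Q' c)"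
    and factor: "\<And>c. c \<in> Ob C \<Longrightarrow> \<theta> c \<cdot>\<^bsub>D\<^esub> \<pi> c = \<xi> c"
  shows "natural_transformation C D Q Q' \<theta>"
proof -
  interpret \<pi>: natural_transformation C D G Q \<pi> by fact
  interpret \<xi>: natural_transformation C D G Q' \<xi> by fact
  show ?thesis
  proof unfold_locales
    fix f X Y assume f: "f \<in> homset C X Y"
    note XY = \<pi>.F.src.homset_Ob[OF f]
    note \<pi>XY = XY[THEN \<pi>.component_in_homset] and \<theta>XY = XY[THEN \<theta>]
    note Gf = \<pi>.F.on_Arr_in_homset[OF f] and Qf = \<pi>.G.on_Arr_in_homset[OF f]
      and Q'f = \<xi>.G.on_Arr_in_homset[OF f]
    note assoc = \<pi>.F.tgt.Comp_assoc and comp = \<pi>.F.tgt.Comp_in_homset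
    have "(\<theta> Y \<cdot>\<^bsub>D\<^esub> on_Arr Q f) \<cdot>\<^bsub>D\<^esub> \<pi> X = \<xi> Y \<cdot>\<^bsub>D\<^esub> on_Arr G f"
      using assoc[OF \<pi>XY(1) Qf \<theta>XY(2)] assoc[OF Gf \<pi>XY(2) \<theta>XY(2)] \<pi>.naturality[OF f]
        factor[OF XY(2)] by simp
    also have "\<dots> = (on_Arr Q' f \<cdot>\<^bsub>D\<^esub> \<theta> X) \<cdot>\<^bsub>D\<^esub> \<pi> X"
      using assoc[OF \<pi>XY(1) \<theta>XY(1) Q'f] \<xi>.naturality[OF f] factor[OF XY(1)] by simp
    finally show "\<theta> Y \<cdot>\<^bsub>D\<^esub> on_Arr Q f = on_Arr Q' f \<cdot>\<^bsub>D\<^esub> \<theta> X"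
      by (rule \<pi>.F.tgt.epicD[OF \<pi>(2)[OF XY(1)] \<pi>XY(1) comp[OF Qf \<theta>XY(2)] comp[OF \<theta>XY(1) Q'f]])
  qed (fact \<theta>)
qed

lemma natural_transformation_postcomp:
  assumes "natural_transformation C D F G \<tau>" "is_functor D E T"
  shows "natural_transformation C E (comp_fctr T F) (comp_fctr T G) (\<lambda>c. on_Arr T (\<tau> c))"
proof -
  interpret \<tau>: natural_transformation C D F G \<tau> by fact
  interpret T: is_functor D E T by fact
  interpret TF: is_functor C E "comp_fctr T F"
    by (rule is_functor_comp_fctr[OF \<tau>.F.is_functor_axioms T.is_functor_axioms])
  interpret TG: is_functor C E "comp_fctr T G"
    by (rule is_functor_comp_fctr[OF \<tau>.G.is_functor_axioms T.is_functor_axioms])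
  show ?thesis
  proof unfold_locales
    fix X assume "X \<in> Ob C"
    then show "on_Arr T (\<tau> X) \<in> homset E (on_Ob (comp_fctr T F) X) (on_Ob (comp_fctr T G) X)"
      using T.on_Arr_in_homset[OF \<tau>.component_in_homset] by (simp add: comp_fctr_def)
  next
    fix f X Y assume f: "f \<in> homset C X Y"
    note \<tau>XY = \<tau>.F.src.homset_Ob[OF f, THEN \<tau>.component_in_homset]
    show "on_Arr T (\<tau> Y) \<cdot>\<^bsub>E\<^esub> on_Arr (comp_fctr T F) f
        = on_Arr (comp_fctr T G) f \<cdot>\<^bsub>E\<^esub> on_Arr T (\<tau> X)"
      using \<tau>.naturality[OF f] T.on_Arr_Comp[OF \<tau>.F.on_Arr_in_homset[OF f] \<tau>XY(2)]
        T.on_Arr_Comp[OF \<tau>XY(1) \<tau>.G.on_Arr_in_homset[OF f]] by (simp add: comp_fctr_def)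
  qed
qed

lemma natural_transformation_precomp:
  assumes "natural_transformation D E F G \<tau>" "is_functor C D S"
  shows "natural_transformation C E (comp_fctr F S) (comp_fctr G S) (\<lambda>c. \<tau> (on_Ob S c))"
proof -
  interpret \<tau>: natural_transformation D E F G \<tau> by fact
  interpret S: is_functor C D S by fact
  interpret FS: is_functor C E "comp_fctr F S"
    by (rule is_functor_comp_fctr[OF S.is_functor_axioms \<tau>.F.is_functor_axioms])
  interpret GS: is_functor C E "comp_fctr G S"
    by (rule is_functor_comp_fctr[OF S.is_functor_axioms \<tau>.G.is_functor_axioms])
  show ?thesis
    using S.on_Ob_in_Ob S.on_Arr_in_homset \<tau>.component_in_homset \<tau>.naturality
    by unfold_locales (auto simp: comp_fctr_def)
qed

section \<open>Right exact sequences of functors\<close>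

definition right_exact_sequence ::
  "('o1, 'a1, 'z1) cat_scheme \<Rightarrow> ('o2, 'a2, 'z2) ab_cat_scheme \<Rightarrow>
    ('o1, 'a1, 'o2, 'a2) fctr \<Rightarrow> ('o1 \<Rightarrow> 'a2) \<Rightarrow> ('o1, 'a1, 'o2, 'a2) fctr \<Rightarrow>
    ('o1 \<Rightarrow> 'a2) \<Rightarrow> ('o1, 'a1, 'o2, 'a2) fctr \<Rightarrow> bool" where
  "right_exact_sequence C A F \<alpha> G \<beta> H \<longleftrightarrow>
    natural_transformation C A F G \<alpha> \<and> natural_transformation C A G H \<beta> \<and>
    (\<forall>c \<in> Ob C. right_exact A (on_Ob F c) (\<alpha> c) (on_Ob G c) (\<beta> c) (on_Ob H c))"

lemma right_exact_sequenceD: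
  assumes "right_exact_sequence C A F \<alpha> G \<beta> H"
  shows "natural_transformation C A F G \<alpha>" "natural_transformation C A G H \<beta>"
    and "\<And>c. c \<in> Ob C \<Longrightarrow> right_exact A (on_Ob F c) (\<alpha> c) (on_Ob G c) (\<beta> c) (on_Ob H c)"
  using assms by (simp_all add: right_exact_sequence_def)

lemma right_exact_sequence_precomp:
  assumes r: "right_exact_sequence D A F \<alpha> G \<beta> H" and S: "is_functor C D S"
  shows "right_exact_sequence C A (comp_fctr F S) (\<lambda>c. \<alpha> (on_Ob S c)) (comp_fctr G S)
    (\<lambda>c. \<beta> (on_Ob S c)) (comp_fctr H S)"
  unfolding right_exact_sequence_def
  using natural_transformation_precomp[OF right_exact_sequenceD(1)[OF r] S]
    natural_transformation_precomp[OF right_exact_sequenceD(2)[OF r] S]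
    right_exact_sequenceD(3)[OF r] is_functor.on_Ob_in_Ob[OF S]
  by (simp add: comp_fctr_def)

context abelian_category
begin

lemma natural_transformation_Zero:
  assumes "is_functor C A F" "is_functor C A G"
  shows "natural_transformation C A F G (\<lambda>c. Zero A (on_Ob F c) (on_Ob G c))"
proof -
  interpret F: is_functor C A F by fact
  interpret G: is_functor C A G by fact
  show ?thesis
  proof unfold_locales
    fix f X Y assume f: "f \<in> homset C X Y"
    note XY = F.src.homset_Ob[OF f]
    show "Zero A (on_Ob F Y) (on_Ob G Y) \<cdot>\<^bsub>A\<^esub> on_Arr F f
        = on_Arr G f \<cdot>\<^bsub>A\<^esub> Zero A (on_Ob F X) (on_Ob G X)"
      using Comp_Zero_left[OF G.on_Ob_in_Ob[OF XY(2)] F.on_Arr_in_homset[OF f]]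
        Comp_Zero_right[OF F.on_Ob_in_Ob[OF XY(1)] G.on_Arr_in_homset[OF f]] by simp
  qed (simp add: Zero_in_homset F.on_Ob_in_Ob G.on_Ob_in_Ob)
qed

lemma right_exact_sequence_Zero_Ident:
  assumes F: "is_functor C A F" and G: "is_functor C A G"
  shows "right_exact_sequence C A F (\<lambda>c. Zero A (on_Ob F c) (on_Ob G c)) G
    (\<lambda>c. Ident A (on_Ob G c)) G"
  using natural_transformation_Zero[OF F G] natural_transformation_Ident[OF G]
    right_exact_Zero_Ident is_functor.on_Ob_in_Ob[OF F] is_functor.on_Ob_in_Ob[OF G]
  by (simp add: right_exact_sequence_def)

lemma right_exact_sequence_coker_fctr:
  assumes \<tau>: "natural_transformation C A F G \<tau>"
  shows "right_exact_sequence C A F \<tau> G (\<lambda>c. coker_proj A (\<tau> c)) (coker_fctr C A G \<tau>)"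
proof -
  interpret \<tau>: natural_transformation C A F G \<tau> by fact
  interpret Q: is_functor C A "coker_fctr C A G \<tau>"
    by (rule is_functor_coker_fctr[OF abelian_category_axioms \<tau>])
  have Q: "on_Ob (coker_fctr C A G \<tau>) c = Cod A (coker_proj A (\<tau> c))" for c
    by (simp add: coker_fctr_def)
  have "natural_transformation C A G (coker_fctr C A G \<tau>) (\<lambda>c. coker_proj A (\<tau> c))"
    using coker_proj_in_homset[OF \<tau>.component_in_homset]
      coker_fctr_on_Arr(2)[OF abelian_category_axioms \<tau>]
    by unfold_locales (simp_all add: Q)
  then show ?thesis
    using \<tau> right_exact_coker_proj[OF \<tau>.component_in_homset]
    by (simp add: right_exact_sequence_def Q)
qed

lemma cokernel_natural_transformation:
  assumes r: "right_exact_sequence C A F \<sigma> G \<pi> Q" and r': "right_exact_sequence C A F' \<sigma>' G' \<pi>' Q'"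
    and \<phi>: "natural_transformation C A F F' \<phi>" and \<psi>: "natural_transformation C A G G' \<psi>"
    and square: "\<And>c. c \<in> Ob C \<Longrightarrow> \<psi> c \<cdot>\<^bsub>A\<^esub> \<sigma> c = \<sigma>' c \<cdot>\<^bsub>A\<^esub> \<phi> c"
  obtains \<theta> where "natural_transformation C A Q Q' \<theta>"
    "\<And>c. c \<in> Ob C \<Longrightarrow> \<theta> c \<cdot>\<^bsub>A\<^esub> \<pi> c = \<pi>' c \<cdot>\<^bsub>A\<^esub> \<psi> c"
proof -
  have "\<exists>h \<in> homset A (on_Ob Q c) (on_Ob Q' c). h \<cdot>\<^bsub>A\<^esub> \<pi> c = \<pi>' c \<cdot>\<^bsub>A\<^esub> \<psi> c" if c: "c \<in> Ob C" for c
    using cokernel_map[OF right_exact_sequenceD(3)[OF r c] right_exact_sequenceD(3)[OF r' c]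
        natural_transformation.component_in_homset[OF \<phi> c]
        natural_transformation.component_in_homset[OF \<psi> c] square[OF c]] by blast
  then obtain \<theta> where \<theta>: "\<And>c. c \<in> Ob C \<Longrightarrow> \<theta> c \<in> homset A (on_Ob Q c) (on_Ob Q' c)"
    "\<And>c. c \<in> Ob C \<Longrightarrow> \<theta> c \<cdot>\<^bsub>A\<^esub> \<pi> c = \<pi>' c \<cdot>\<^bsub>A\<^esub> \<psi> c"
    by metis
  have "natural_transformation C A Q Q' \<theta>"
    by (rule natural_transformation_if_Comp_epic[OF right_exact_sequenceD(2)[OF r]
          right_exact_epic[OF right_exact_sequenceD(3)[OF r]]
          natural_transformation_Comp[OF \<psi> right_exact_sequenceD(2)[OF r']] \<theta>])
  then show ?thesis using that \<theta>(2) by blast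
qed

lemma right_exact_sequence_cokernels:
  assumes r1: "right_exact_sequence C A F1 \<sigma>1 G1 \<pi>1 Q1"
    and r2: "right_exact_sequence C A F2 \<sigma>2 G2 \<pi>2 Q2"
    and r3: "right_exact_sequence C A F3 \<sigma>3 G3 \<pi>3 Q3"
    and \<phi>: "natural_transformation C A F1 F2 \<phi>"
    and \<phi>': "natural_transformation C A F2 F3 \<phi>'" "\<And>c. c \<in> Ob C \<Longrightarrow> epic A (\<phi>' c)"
    and r: "right_exact_sequence C A G1 \<psi> G2 \<psi>' G3"
    and square: "\<And>c. c \<in> Ob C \<Longrightarrow> \<psi> c \<cdot>\<^bsub>A\<^esub> \<sigma>1 c = \<sigma>2 c \<cdot>\<^bsub>A\<^esub> \<phi> c"
    and square': "\<And>c. c \<in> Ob C \<Longrightarrow> \<psi>' c \<cdot>\<^bsub>A\<^esub> \<sigma>2 c = \<sigma>3 c \<cdot>\<^bsub>A\<^esub> \<phi>' c"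
  obtains \<theta> \<theta>' where "right_exact_sequence C A Q1 \<theta> Q2 \<theta>' Q3"
proof -
  obtain \<theta> where \<theta>: "natural_transformation C A Q1 Q2 \<theta>"
    "\<And>c. c \<in> Ob C \<Longrightarrow> \<theta> c \<cdot>\<^bsub>A\<^esub> \<pi>1 c = \<pi>2 c \<cdot>\<^bsub>A\<^esub> \<psi> c"
    using cokernel_natural_transformation[OF r1 r2 \<phi> right_exact_sequenceD(1)[OF r] square] by blast
  obtain \<theta>' where \<theta>': "natural_transformation C A Q2 Q3 \<theta>'"
    "\<And>c. c \<in> Ob C \<Longrightarrow> \<theta>' c \<cdot>\<^bsub>A\<^esub> \<pi>2 c = \<pi>3 c \<cdot>\<^bsub>A\<^esub> \<psi>' c"
    using cokernel_natural_transformation[OF r2 r3 \<phi>'(1) right_exact_sequenceD(2)[OF r] square']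
    by blast
  have "right_exact A (on_Ob Q1 c) (\<theta> c) (on_Ob Q2 c) (\<theta>' c) (on_Ob Q3 c)" if c: "c \<in> Ob C" for c
    by (rule right_exact_cokernels[OF right_exact_sequenceD(3)[OF r1 c]
          right_exact_sequenceD(3)[OF r2 c] right_exact_sequenceD(3)[OF r3 c]
          natural_transformation.component_in_homset[OF \<phi>'(1) c] \<phi>'(2)[OF c]
          right_exact_sequenceD(3)[OF r c] natural_transformation.component_in_homset[OF \<theta>(1) c]
          natural_transformation.component_in_homset[OF \<theta>'(1) c]
          square'[OF c] \<theta>(2)[OF c] \<theta>'(2)[OF c]])
  then show ?thesis
    using that[of \<theta> \<theta>'] \<theta>(1) \<theta>'(1) by (simp add: right_exact_sequence_def)
qed

lemma right_exact_sequence_coker_fctr_Comp: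
  assumes \<sigma>: "natural_transformation C A F G \<sigma>" and \<tau>: "natural_transformation C A G H \<tau>"
    and \<rho>: "natural_transformation C A F H \<rho>" "\<And>c. c \<in> Ob C \<Longrightarrow> \<rho> c = \<tau> c \<cdot>\<^bsub>A\<^esub> \<sigma> c"
  obtains \<theta> \<theta>' where
    "right_exact_sequence C A (coker_fctr C A G \<sigma>) \<theta> (coker_fctr C A H \<rho>) \<theta>' (coker_fctr C A H \<tau>)"
proof -
  interpret \<sigma>: natural_transformation C A F G \<sigma> by fact
  interpret \<tau>: natural_transformation C A G H \<tau> by fact
  interpret \<rho>: natural_transformation C A F H \<rho> by fact
  note Ident_F = natural_transformation_Ident[OF \<sigma>.F.is_functor_axioms]
  note coker_\<tau> = right_exact_sequence_coker_fctr[OF \<tau>]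
  interpret \<pi>: natural_transformation C A H "coker_fctr C A H \<tau>" "\<lambda>c. coker_proj A (\<tau> c)"
    by (rule right_exact_sequenceD(2)[OF coker_\<tau>])
  show ?thesis
  proof (rule right_exact_sequence_cokernels[OF right_exact_sequence_coker_fctr[OF \<sigma>]
        right_exact_sequence_coker_fctr[OF \<rho>(1)]
        right_exact_sequence_Zero_Ident[OF \<sigma>.F.is_functor_axioms \<pi>.G.is_functor_axioms]
        Ident_F Ident_F _ coker_\<tau> _ _ that])
    fix c assume c: "c \<in> Ob C"
    note Fc = \<sigma>.F.on_Ob_in_Ob[OF c] and Qc = \<pi>.G.on_Ob_in_Ob[OF c]
    note \<sigma>c = \<sigma>.component_in_homset[OF c] and \<tau>c = \<tau>.component_in_homset[OF c]
      and \<pi>c = \<pi>.component_in_homset[OF c]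
    show "epic A (Ident A (on_Ob F c))" by (rule epic_Ident[OF Fc])
    show "\<tau> c \<cdot>\<^bsub>A\<^esub> \<sigma> c = \<rho> c \<cdot>\<^bsub>A\<^esub> Ident A (on_Ob F c)"
      using Ident_right[OF \<rho>.component_in_homset[OF c]] \<rho>(2)[OF c] by simp
    show "coker_proj A (\<tau> c) \<cdot>\<^bsub>A\<^esub> \<rho> c
        = Zero A (on_Ob F c) (on_Ob (coker_fctr C A H \<tau>) c) \<cdot>\<^bsub>A\<^esub> Ident A (on_Ob F c)"
      using \<rho>(2)[OF c] Comp_assoc[OF \<sigma>c \<tau>c \<pi>c] right_exactD(3)[OF right_exact_sequenceD(3)[OF coker_\<tau> c]]
        Comp_Zero_left[OF Qc \<sigma>c] Ident_right[OF Zero_in_homset[OF Fc Qc]] by simp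
  qed
qed

end

section \<open>Closure properties of the degree\<close>

abbreviation diff_fctr ::
  "('o1, 'a1, 'z1) cat_scheme \<Rightarrow> ('o2, 'a2, 'z2) ab_cat_scheme \<Rightarrow>
    ('o1, 'a1, 'o1, 'a1) fctr \<Rightarrow> ('o1 \<Rightarrow> 'a1) \<Rightarrow>
    ('o1, 'a1, 'o2, 'a2) fctr \<Rightarrow> ('o1, 'a1, 'o2, 'a2) fctr" where
  "diff_fctr C A S \<kappa> T \<equiv> coker_fctr C A (comp_fctr T S) (\<lambda>c. on_Arr T (\<kappa> c))"

lemma (in abelian_category) right_exact_sequence_diff_fctr:
  assumes S: "natural_transformation C C id_fctr S \<kappa>"
    and r: "right_exact_sequence C A F \<alpha> G \<beta> H"
  obtains \<theta> \<theta>' where "right_exact_sequence C A (diff_fctr C A S \<kappa> F) \<theta> (diff_fctr C A S \<kappa> G) \<theta>'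
    (diff_fctr C A S \<kappa> H)"
proof -
  interpret S: natural_transformation C C id_fctr S \<kappa> by fact
  interpret \<alpha>: natural_transformation C A F G \<alpha> by (rule right_exact_sequenceD(1)[OF r])
  interpret \<beta>: natural_transformation C A G H \<beta> by (rule right_exact_sequenceD(2)[OF r])
  note diff = right_exact_sequence_coker_fctr[OF natural_transformation_whisker[OF S]]
  have \<kappa>: "\<kappa> c \<in> homset C c (on_Ob S c)" if "c \<in> Ob C" for c
    using S.component_in_homset[OF that] by (simp add: id_fctr_def)
  show ?thesis
    by (rule right_exact_sequence_cokernels[OF diff[OF \<alpha>.F.is_functor_axioms]
          diff[OF \<alpha>.G.is_functor_axioms] diff[OF \<beta>.G.is_functor_axioms]
          \<alpha>.natural_transformation_axioms \<beta>.natural_transformation_axioms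
          right_exact_epic[OF right_exact_sequenceD(3)[OF r]]
          right_exact_sequence_precomp[OF r S.G.is_functor_axioms]
          \<alpha>.naturality[OF \<kappa>] \<beta>.naturality[OF \<kappa>] that])
qed

locale functor_degree =
  A: abelian_category A
  for C :: "('o1, 'a1, 'z1) cat_scheme"
    and A :: "('o2, 'a2, 'z2) ab_cat_scheme"
    and I :: "'i set"
    and s :: "'i \<Rightarrow> ('o1, 'a1, 'o1, 'a1) fctr"
    and \<iota> :: "'i \<Rightarrow> 'o1 \<Rightarrow> 'a1" +
  assumes stabiliser: "i \<in> I \<Longrightarrow> natural_transformation C C id_fctr (s i) (\<iota> i)"
begin

abbreviation deg_lt :: "nat \<Rightarrow> ('o1, 'a1, 'o2, 'a2) fctr \<Rightarrow> bool" where
  "deg_lt \<equiv> degree_lt C A I s \<iota>"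

lemmas deg_lt_Suc = degree_lt_Suc[OF A.abelian_category_axioms stabiliser]

lemma deg_lt_if_zero_fctr:
  assumes "is_functor C A T" "zero_fctr C A T"
  shows "deg_lt n T"
proof (induction n)
  case 0
  show ?case using assms(2) by simp
next
  case (Suc n)
  show ?case by (rule deg_lt_Suc[OF _ assms(1) Suc])
qed

lemma deg_lt_right_exact:
  assumes "right_exact_sequence C A F \<alpha> G \<beta> H" "deg_lt n F" "deg_lt n H"
  shows "deg_lt n G"
  using assms
proof (induction n arbitrary: F \<alpha> G \<beta> H)
  case 0
  then show ?case
    using A.right_exact_null_middle[OF right_exact_sequenceD(3)] by (fastforce simp: zero_fctr_def)
next
  case (Suc n)
  have "deg_lt n (diff_fctr C A (s i) (\<iota> i) G)" if i: "i \<in> I" for i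
  proof -
    obtain \<theta> \<theta>' where "right_exact_sequence C A (diff_fctr C A (s i) (\<iota> i) F) \<theta>
        (diff_fctr C A (s i) (\<iota> i) G) \<theta>' (diff_fctr C A (s i) (\<iota> i) H)"
      by (rule A.right_exact_sequence_diff_fctr[OF stabiliser[OF i] Suc.prems(1)])
    then show ?thesis using Suc.IH Suc.prems(2,3) i by simp
  qed
  then show ?case by simp
qed

lemma deg_lt_coker_fctr_Comp:
  assumes "natural_transformation C A F G \<sigma>" "natural_transformation C A G H \<tau>"
    and "natural_transformation C A F H \<rho>" "\<And>c. c \<in> Ob C \<Longrightarrow> \<rho> c = \<tau> c \<cdot>\<^bsub>A\<^esub> \<sigma> c"
    and deg: "deg_lt n (coker_fctr C A G \<sigma>)" "deg_lt n (coker_fctr C A H \<tau>)"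
  shows "deg_lt n (coker_fctr C A H \<rho>)"
proof -
  obtain \<theta> \<theta>' where "right_exact_sequence C A
      (coker_fctr C A G \<sigma>) \<theta> (coker_fctr C A H \<rho>) \<theta>' (coker_fctr C A H \<tau>)"
    by (rule A.right_exact_sequence_coker_fctr_Comp[OF assms(1-4)])
  then show ?thesis using deg by (rule deg_lt_right_exact)
qed

lemma deg_lt_coker_fctr_epic:
  assumes \<tau>: "natural_transformation C A F G \<tau>" and epic: "\<And>c. c \<in> Ob C \<Longrightarrow> epic A (\<tau> c)"
  shows "deg_lt n (coker_fctr C A G \<tau>)"
proof (rule deg_lt_if_zero_fctr)
  note r = A.right_exact_sequence_coker_fctr[OF \<tau>]
  show "is_functor C A (coker_fctr C A G \<tau>)"
    by (rule is_functor_coker_fctr[OF A.abelian_category_axioms \<tau>])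
  show "zero_fctr C A (coker_fctr C A G \<tau>)"
    using A.right_exact_null_right[OF right_exact_sequenceD(3)[OF r] epic]
    by (simp add: zero_fctr_def)
qed

lemma deg_lt_coker_fctr_isomorphism:
  assumes \<mu>: "natural_transformation C C S S' \<mu>" "\<And>c. c \<in> Ob C \<Longrightarrow> isomorphism C (\<mu> c)"
    and T: "is_functor C A T"
  shows "deg_lt n (coker_fctr C A (comp_fctr T S') (\<lambda>c. on_Arr T (\<mu> c)))"
proof (rule deg_lt_coker_fctr_epic[OF natural_transformation_postcomp[OF \<mu>(1) T]])
  interpret T: is_functor C A T by fact
  fix c
  assume c: "c \<in> Ob C"
  note \<mu>_c = natural_transformation.component_in_homset[OF \<mu>(1) c]
  show "epic A (on_Arr T (\<mu> c))"
    by (rule A.isomorphism_epic[OF T.isomorphism_on_Arr[OF \<mu>(2)[OF c] \<mu>_c] T.on_Arr_in_homset[OF \<mu>_c]])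
qed

section \<open>Degree-lowering endofunctors\<close>

definition degree_lowering :: "('o1, 'a1, 'o1, 'a1) fctr \<Rightarrow> ('o1 \<Rightarrow> 'a1) \<Rightarrow> bool" where
  "degree_lowering S \<kappa> \<longleftrightarrow> natural_transformation C C id_fctr S \<kappa> \<and>
    (\<forall>n T. is_functor C A T \<longrightarrow> deg_lt (Suc n) T \<longrightarrow> deg_lt n (diff_fctr C A S \<kappa> T))"

lemma degree_loweringD:
  assumes "degree_lowering S \<kappa>"
  shows "natural_transformation C C id_fctr S \<kappa>"
    and "is_functor C A T \<Longrightarrow> deg_lt (Suc n) T \<Longrightarrow> deg_lt n (diff_fctr C A S \<kappa> T)"
  using assms by (simp_all only: degree_lowering_def)

lemma degree_lowering_stabiliser:
  assumes "i \<in> I"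
  shows "degree_lowering (s i) (\<iota> i)"
  using assms stabiliser by (simp add: degree_lowering_def)

lemma degree_lowering_if_isomorphism:
  assumes "natural_transformation C C id_fctr S \<kappa>" "\<And>c. c \<in> Ob C \<Longrightarrow> isomorphism C (\<kappa> c)"
  shows "degree_lowering S \<kappa>"
  using assms deg_lt_coker_fctr_isomorphism[OF assms] by (simp add: degree_lowering_def)

lemma degree_lowering_transport:
  assumes S: "degree_lowering S \<kappa>"
    and \<mu>: "natural_transformation C C S S' \<mu>" "\<And>c. c \<in> Ob C \<Longrightarrow> isomorphism C (\<mu> c)"
    and \<kappa>': "natural_transformation C C id_fctr S' \<kappa>'" "\<And>c. c \<in> Ob C \<Longrightarrow> \<kappa>' c = \<mu> c \<cdot>\<^bsub>C\<^esub> \<kappa> c"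
  shows "degree_lowering S' \<kappa>'"
  unfolding degree_lowering_def
proof (intro conjI allI impI \<kappa>'(1))
  fix n T
  assume T: "is_functor C A T" and deg: "deg_lt (Suc n) T"
  interpret T: is_functor C A T by fact
  interpret \<kappa>: natural_transformation C C id_fctr S \<kappa> by (rule degree_loweringD(1)[OF S])
  interpret \<mu>: natural_transformation C C S S' \<mu> by fact
  show "deg_lt n (diff_fctr C A S' \<kappa>' T)"
  proof (rule deg_lt_coker_fctr_Comp[OF natural_transformation_whisker[OF degree_loweringD(1)[OF S] T]
        natural_transformation_postcomp[OF \<mu>(1) T] natural_transformation_whisker[OF \<kappa>'(1) T]])
    show "on_Arr T (\<kappa>' c) = on_Arr T (\<mu> c) \<cdot>\<^bsub>A\<^esub> on_Arr T (\<kappa> c)" if "c \<in> Ob C" for c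
      using T.on_Arr_Comp[OF \<kappa>.component_in_homset[OF that] \<mu>.component_in_homset[OF that]]
        \<kappa>'(2)[OF that] by simp
    show "deg_lt n (diff_fctr C A S \<kappa> T)" by (rule degree_loweringD(2)[OF S T deg])
    show "deg_lt n (coker_fctr C A (comp_fctr T S') (\<lambda>c. on_Arr T (\<mu> c)))"
      by (rule deg_lt_coker_fctr_isomorphism[OF \<mu> T])
  qed
qed

lemma deg_lt_comp_fctr:
  assumes S: "degree_lowering S \<kappa>" and T: "is_functor C A T" and deg: "deg_lt n T"
  shows "deg_lt n (comp_fctr T S)"
proof (rule deg_lt_right_exact)
  show "right_exact_sequence C A T (\<lambda>c. on_Arr T (\<kappa> c)) (comp_fctr T S)
      (\<lambda>c. coker_proj A (on_Arr T (\<kappa> c))) (diff_fctr C A S \<kappa> T)"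
    by (rule A.right_exact_sequence_coker_fctr[OF
          natural_transformation_whisker[OF degree_loweringD(1)[OF S] T]])
  show "deg_lt n T" by fact
  show "deg_lt n (diff_fctr C A S \<kappa> T)"
    by (rule degree_loweringD(2)[OF S T deg_lt_Suc[OF _ T deg]])
qed

lemma degree_lowering_comp:
  assumes S: "degree_lowering S \<kappa>" and S': "degree_lowering S' \<kappa>'"
  shows "degree_lowering (comp_fctr S S') (\<lambda>c. on_Arr S (\<kappa>' c) \<cdot>\<^bsub>C\<^esub> \<kappa> c)"
    (is "degree_lowering ?SS' ?\<kappa>\<kappa>'")
  unfolding degree_lowering_def
proof (intro conjI allI impI)
  interpret \<kappa>: natural_transformation C C id_fctr S \<kappa> by (rule degree_loweringD(1)[OF S])
  note S_fctr = \<kappa>.G.is_functor_axioms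
  note S\<kappa>' = natural_transformation_whisker[OF degree_loweringD(1)[OF S'] S_fctr]
  show \<kappa>\<kappa>': "natural_transformation C C id_fctr ?SS' ?\<kappa>\<kappa>'"
    by (rule natural_transformation_Comp[OF \<kappa>.natural_transformation_axioms S\<kappa>'])
  fix n T
  assume T: "is_functor C A T" and deg: "deg_lt (Suc n) T"
  interpret T: is_functor C A T by fact
  note TS = is_functor_comp_fctr[OF S_fctr T]
  show "deg_lt n (diff_fctr C A ?SS' ?\<kappa>\<kappa>' T)"
    unfolding comp_fctr_assoc[symmetric]
  proof (rule deg_lt_coker_fctr_Comp)
    show "natural_transformation C A T (comp_fctr T S) (\<lambda>c. on_Arr T (\<kappa> c))"
      by (rule natural_transformation_whisker[OF \<kappa>.natural_transformation_axioms T])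
    show "natural_transformation C A (comp_fctr T S) (comp_fctr (comp_fctr T S) S')
        (\<lambda>c. on_Arr (comp_fctr T S) (\<kappa>' c))"
      by (rule natural_transformation_whisker[OF degree_loweringD(1)[OF S'] TS])
    show "natural_transformation C A T (comp_fctr (comp_fctr T S) S') (\<lambda>c. on_Arr T (?\<kappa>\<kappa>' c))"
      unfolding comp_fctr_assoc by (rule natural_transformation_whisker[OF \<kappa>\<kappa>' T])
    show "on_Arr T (?\<kappa>\<kappa>' c) = on_Arr (comp_fctr T S) (\<kappa>' c) \<cdot>\<^bsub>A\<^esub> on_Arr T (\<kappa> c)"
      if c: "c \<in> Ob C" for c
      using T.on_Arr_Comp[OF \<kappa>.component_in_homset[OF c]
          natural_transformation.component_in_homset[OF S\<kappa>' c]] by (simp add: comp_fctr_def)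
    show "deg_lt n (diff_fctr C A S \<kappa> T)" by (rule degree_loweringD(2)[OF S T deg])
    show "deg_lt n (diff_fctr C A S' \<kappa>' (comp_fctr T S))"
      by (rule degree_loweringD(2)[OF S' TS deg_lt_comp_fctr[OF S T deg]])
  qed
qed

lemma degree_lt_if_degree_lowering:
  assumes J: "\<And>j. j \<in> J \<Longrightarrow> degree_lowering (s j) (\<iota> j)"
    and "is_functor C A T" "deg_lt n T"
  shows "degree_lt C A J s \<iota> n T"
  using assms(2-)
proof (induction n arbitrary: T)
  case 0
  then show ?case by simp
next
  case (Suc n)
  have "degree_lt C A J s \<iota> n (diff_fctr C A (s j) (\<iota> j) T)" if j: "j \<in> J" for j
    by (rule Suc.IH[OF is_functor_coker_fctr[OF A.abelian_category_axioms
            natural_transformation_whisker[OF degree_loweringD(1)[OF J[OF j]] Suc.prems(1)]]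
          degree_loweringD(2)[OF J[OF j] Suc.prems]])
  then show ?case by simp
qed

lemma degree_eq_if_degree_lowering:
  assumes "I \<subseteq> J" and "\<And>j. j \<in> J \<Longrightarrow> degree_lowering (s j) (\<iota> j)" and "is_functor C A T"
  shows "degree C A I s \<iota> T = degree C A J s \<iota> T"
proof -
  have "deg_lt n T" if "degree_lt C A J s \<iota> n T" for n T
    using that by (induction n arbitrary: T) (use \<open>I \<subseteq> J\<close> in auto)
  then have "deg_lt n T \<longleftrightarrow> degree_lt C A J s \<iota> n T" for n
    using degree_lt_if_degree_lowering[OF assms(2,3)] by blast
  then show ?thesis by (simp add: degree_def)
qed

end

section \<open>Stabilisers of left-modules\<close>

lemma homset_prod_cat_iff:
  "(u, f) \<in> homset (prod_cat C D) (a, c) (b, d) \<longleftrightarrow> u \<in> homset C a b \<and> f \<in> homset D c d"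
  by (auto simp: homset_def prod_cat_def)

lemma on_Arr_prod_cat_Comp:
  assumes "is_functor (prod_cat C1 C2) D F" "u \<in> homset C1 a b" "v \<in> homset C1 b c"
    and "f \<in> homset C2 a' b'" "g \<in> homset C2 b' c'"
  shows "on_Arr F (v, g) \<cdot>\<^bsub>D\<^esub> on_Arr F (u, f) = on_Arr F (v \<cdot>\<^bsub>C1\<^esub> u, g \<cdot>\<^bsub>C2\<^esub> f)"
  using is_functor.on_Arr_Comp[OF assms(1), of "(u, f)" "(a, a')" "(b, b')" "(v, g)" "(c, c')"]
    assms(2-) by (simp add: homset_prod_cat_iff) (simp add: prod_cat_def)

definition orbit_fctr ::
  "('co, 'ca, 'y) cat_scheme \<Rightarrow> ('mo \<times> 'co, 'ma \<times> 'ca, 'co, 'ca) fctr \<Rightarrow> 'co \<Rightarrow>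
    ('mo, 'ma, 'co, 'ca) fctr" where
  "orbit_fctr C act c =
    \<lparr>on_Ob = (\<lambda>y. on_Ob act (y, c)), on_Arr = (\<lambda>u. on_Arr act (u, Ident C c))\<rparr>"

context strict_left_module
begin

lemma act_in_homset:
  assumes "u \<in> homset M a b" "f \<in> homset C c d"
  shows "on_Arr act (u, f) \<in> homset C (on_Ob act (a, c)) (on_Ob act (b, d))"
  using action.on_Arr_in_homset assms by (simp add: homset_prod_cat_iff)

lemmas act_Comp = on_Arr_prod_cat_Comp[OF action.is_functor_axioms]

lemma tensor_Arr_in_homset:
  assumes "u \<in> homset M a b" "v \<in> homset M c d"
  shows "tensor_Arr M u v \<in> homset M (tensor_Ob M a c) (tensor_Ob M b d)"
  using tensor.on_Arr_in_homset assms by (simp add: homset_prod_cat_iff)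

lemma tensor_Ident:
  assumes "y \<in> Ob M" "z \<in> Ob M"
  shows "tensor_Arr M (Ident M y) (Ident M z) = Ident M (tensor_Ob M y z)"
  using tensor.on_Arr_Ident[of "(y, z)"] assms by (simp add: prod_cat_def)

lemma tensor_in_Ob:
  assumes "y \<in> Ob M" "z \<in> Ob M"
  shows "tensor_Ob M y z \<in> Ob M"
  using tensor.on_Ob_in_Ob[of "(y, z)"] assms by (simp add: prod_cat_def)

lemma tensor_power_in_Ob:
  assumes "x \<in> Ob M"
  shows "tensor_power M x k \<in> Ob M"
  by (induction k) (simp_all add: assms Unit_in_Ob tensor_in_Ob)

lemma is_functor_orbit:
  assumes c: "c \<in> Ob C"
  shows "is_functor M C (orbit_fctr C act c)"
proof -
  note id_c = module.Ident_in_homset[OF c]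
  show ?thesis
  proof unfold_locales
    fix y assume "y \<in> Ob M"
    then show "on_Ob (orbit_fctr C act c) y \<in> Ob C"
      "on_Arr (orbit_fctr C act c) (Ident M y) = Ident C (on_Ob (orbit_fctr C act c) y)"
      using c action.on_Ob_in_Ob[of "(y, c)"] action.on_Arr_Ident[of "(y, c)"]
      by (simp_all add: orbit_fctr_def prod_cat_def)
  qed (use act_in_homset[OF _ id_c] act_Comp[OF _ _ id_c id_c] module.Ident_left[OF id_c]
      in \<open>simp_all add: orbit_fctr_def\<close>)
qed

end

locale initial_left_module = strict_left_module M C act
  for M :: "('mo, 'ma, 'z) monoidal_cat_scheme"
    and C :: "('co, 'ca, 'y) cat_scheme"
    and act :: "('mo \<times> 'co, 'ma \<times> 'ca, 'co, 'ca) fctr" +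
  assumes initial_Unit: "initial_object M (Unit M)"
begin

abbreviation s :: "'mo \<Rightarrow> ('co, 'ca, 'co, 'ca) fctr" where "s \<equiv> stab M act"
abbreviation \<iota> :: "'mo \<Rightarrow> 'co \<Rightarrow> 'ca" where "\<iota> \<equiv> stab_trans M C act"

lemma stabiliser_natural:
  assumes "y \<in> Ob M"
  shows "natural_transformation C C id_fctr (s y) (\<iota> y)"
  by (rule stab_natural[OF strict_left_module_axioms initial_Unit assms])

lemma from_Unit_in_homset:
  assumes "y \<in> Ob M"
  shows "from_Unit M y \<in> homset M (Unit M) y"
  using theI'[of "\<lambda>f. f \<in> homset M (Unit M) y"] initial_Unit assms
  unfolding from_Unit_def initial_object_def by blast

lemma from_Unit_unique:
  assumes "f \<in> homset M (Unit M) y"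
  shows "from_Unit M y = f"
  using from_Unit_in_homset[of y] initial_Unit assms homset_Ob(2)[OF assms]
  unfolding initial_object_def by blast

lemma stab_trans_eq_orbit: "\<iota> y c = on_Arr (orbit_fctr C act c) (from_Unit M y)"
  by (simp add: stab_trans_def orbit_fctr_def)

lemma stab_natural_transformation:
  assumes u: "u \<in> homset M y z"
  shows "natural_transformation C C (s y) (s z) (\<lambda>c. on_Arr (orbit_fctr C act c) u)"
proof -
  note yz = homset_Ob[OF u]
  interpret y: natural_transformation C C id_fctr "s y" "\<iota> y" by (rule stabiliser_natural[OF yz(1)])
  interpret z: natural_transformation C C id_fctr "s z" "\<iota> z" by (rule stabiliser_natural[OF yz(2)])
  note id_y = Ident_in_homset[OF yz(1)] and id_z = Ident_in_homset[OF yz(2)]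
  show ?thesis
  proof unfold_locales
    fix c assume "c \<in> Ob C"
    then show "on_Arr (orbit_fctr C act c) u \<in> homset C (on_Ob (s y) c) (on_Ob (s z) c)"
      using act_in_homset[OF u module.Ident_in_homset] by (simp add: orbit_fctr_def stab_def)
  next
    fix f c d assume f: "f \<in> homset C c d"
    note id_cd = module.homset_Ob[OF f, THEN module.Ident_in_homset]
    show "on_Arr (orbit_fctr C act d) u \<cdot>\<^bsub>C\<^esub> on_Arr (s y) f
        = on_Arr (s z) f \<cdot>\<^bsub>C\<^esub> on_Arr (orbit_fctr C act c) u"
      using act_Comp[OF id_y u f id_cd(2)] act_Comp[OF u id_z id_cd(1) f]
        Ident_left[OF u] Ident_right[OF u] module.Ident_left[OF f] module.Ident_right[OF f]
      by (simp add: orbit_fctr_def stab_def)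
  qed
qed

lemma stab_trans_Comp:
  assumes u: "u \<in> homset M y z" and c: "c \<in> Ob C"
  shows "\<iota> z c = on_Arr (orbit_fctr C act c) u \<cdot>\<^bsub>C\<^esub> \<iota> y c"
proof -
  note i_y = from_Unit_in_homset[OF homset_Ob(1)[OF u]]
  have "from_Unit M z = u \<cdot>\<^bsub>M\<^esub> from_Unit M y"
    by (rule from_Unit_unique[OF Comp_in_homset[OF i_y u]])
  then show ?thesis
    using is_functor.on_Arr_Comp[OF is_functor_orbit[OF c] i_y u] by (simp add: stab_trans_eq_orbit)
qed

lemma stab_tensor_on_Ob:
  assumes "y \<in> Ob M" "z \<in> Ob M" "c \<in> Ob C"
  shows "on_Ob (s (tensor_Ob M y z)) c = on_Ob (comp_fctr (s y) (s z)) c"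
  by (simp add: comp_fctr_def stab_def act_assoc_Ob assms)

lemma stab_tensor_on_Arr:
  assumes "y \<in> Ob M" "z \<in> Ob M" "f \<in> Arr C"
  shows "on_Arr (s (tensor_Ob M y z)) f = on_Arr (comp_fctr (s y) (s z)) f"
  using act_assoc_Arr[of "Ident M y" "Ident M z" f] Ident_in_homset tensor_Ident assms
  by (simp add: comp_fctr_def stab_def homset_def)

lemma stab_trans_tensor:
  assumes y: "y \<in> Ob M" and z: "z \<in> Ob M" and c: "c \<in> Ob C"
  shows "\<iota> (tensor_Ob M y z) c = on_Arr (s y) (\<iota> z c) \<cdot>\<^bsub>C\<^esub> \<iota> y c"
proof -
  let ?u = "tensor_Arr M (Ident M y) (from_Unit M z)"
  have "?u \<in> homset M y (tensor_Ob M y z)"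
    using tensor_Arr_in_homset[OF Ident_in_homset[OF y] from_Unit_in_homset[OF z]]
      Unit_right_Ob[OF y] by simp
  moreover have "on_Arr (s y) (\<iota> z c) = on_Arr (orbit_fctr C act c) ?u"
    using act_assoc_Arr[of "Ident M y" "from_Unit M z" "Ident C c"] Ident_in_homset[OF y]
      from_Unit_in_homset[OF z] module.Ident_in_homset[OF c]
    by (simp add: stab_def stab_trans_def orbit_fctr_def homset_def)
  ultimately show ?thesis using stab_trans_Comp c by simp
qed

text \<open>
  The two functors differ outside the objects and arrows of \<open>C\<close>, where \<open>act\<close> is arbitrary, so
  they are compared by a natural transformation instead of an equation.
\<close>

lemma stab_tensor_natural_transformation:
  assumes y: "y \<in> Ob M" and z: "z \<in> Ob M"
  shows "natural_transformation C C (comp_fctr (s y) (s z)) (s (tensor_Ob M y z))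
    (\<lambda>c. Ident C (on_Ob (comp_fctr (s y) (s z)) c))"
proof -
  let ?S = "comp_fctr (s y) (s z)"
  note functor_stab = natural_transformation.axioms(2)[OF stabiliser_natural]
  interpret S: is_functor C C ?S
    by (rule is_functor_comp_fctr[OF functor_stab[OF z] functor_stab[OF y]])
  interpret yz: is_functor C C "s (tensor_Ob M y z)"
    by (rule functor_stab[OF tensor_in_Ob[OF y z]])
  interpret Ident: natural_transformation C C ?S ?S "\<lambda>c. Ident C (on_Ob ?S c)"
    by (rule natural_transformation_Ident[OF S.is_functor_axioms])
  show ?thesis
  proof unfold_locales
    fix f c d assume f: "f \<in> homset C c d"
    then have "on_Arr (s (tensor_Ob M y z)) f = on_Arr ?S f"
      using stab_tensor_on_Arr[OF y z] by (simp add: homset_def)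
    then show "Ident C (on_Ob ?S d) \<cdot>\<^bsub>C\<^esub> on_Arr ?S f
        = on_Arr (s (tensor_Ob M y z)) f \<cdot>\<^bsub>C\<^esub> Ident C (on_Ob ?S c)"
      using Ident.naturality[OF f] by simp
  qed (simp add: Ident.component_in_homset stab_tensor_on_Ob[OF y z])
qed

end

locale left_module_degree = initial_left_module M C act + A: abelian_category A
  for M :: "('mo, 'ma, 'z) monoidal_cat_scheme"
    and C :: "('co, 'ca, 'y) cat_scheme"
    and act :: "('mo \<times> 'co, 'ma \<times> 'ca, 'co, 'ca) fctr"
    and A :: "('ao, 'aa, 'w) ab_cat_scheme" +
  fixes I :: "'mo set"
  assumes subset_Ob: "I \<subseteq> Ob M"
begin

sublocale functor_degree C A I s \<iota>
  using subset_Ob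
  by (intro functor_degree.intro functor_degree_axioms.intro A.abelian_category_axioms
      stabiliser_natural) blast

lemma degree_lowering_stab_Unit: "degree_lowering (s (Unit M)) (\<iota> (Unit M))"
proof (rule degree_lowering_if_isomorphism[OF stabiliser_natural[OF Unit_in_Ob]])
  fix c assume c: "c \<in> Ob C"
  have "from_Unit M (Unit M) = Ident M (Unit M)"
    by (rule from_Unit_unique[OF Ident_in_homset[OF Unit_in_Ob]])
  then show "isomorphism C (\<iota> (Unit M) c)"
    using is_functor.isomorphism_on_Arr[OF is_functor_orbit[OF c] isomorphism_Ident[OF Unit_in_Ob]
        Ident_in_homset[OF Unit_in_Ob]] by (simp add: stab_trans_eq_orbit)
qed

lemma degree_lowering_stab_isomorphic:
  assumes "isomorphic M y z" and y: "degree_lowering (s y) (\<iota> y)"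
  shows "degree_lowering (s z) (\<iota> z)"
proof -
  obtain u where u: "u \<in> homset M y z" "isomorphism M u"
    using \<open>isomorphic M y z\<close> by (auto simp: isomorphic_def)
  show ?thesis
    by (rule degree_lowering_transport[OF y stab_natural_transformation[OF u(1)]
          is_functor.isomorphism_on_Arr[OF is_functor_orbit u(2,1)]
          stabiliser_natural[OF homset_Ob(2)[OF u(1)]] stab_trans_Comp[OF u(1)]])
qed

lemma degree_lowering_stab_tensor:
  assumes y: "y \<in> Ob M" "degree_lowering (s y) (\<iota> y)" and z: "z \<in> Ob M" "degree_lowering (s z) (\<iota> z)"
  shows "degree_lowering (s (tensor_Ob M y z)) (\<iota> (tensor_Ob M y z))"
proof (rule degree_lowering_transport[OF degree_lowering_comp[OF y(2) z(2)]
      stab_tensor_natural_transformation[OF y(1) z(1)]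
      _ stabiliser_natural[OF tensor_in_Ob[OF y(1) z(1)]]])
  fix c assume c: "c \<in> Ob C"
  note \<iota>_c = natural_transformation.component_in_homset[OF
      degree_loweringD(1)[OF degree_lowering_comp[OF y(2) z(2)]] c]
  show "isomorphism C (Ident C (on_Ob (comp_fctr (s y) (s z)) c))"
    by (rule module.isomorphism_Ident[OF module.homset_Ob(2)[OF \<iota>_c]])
  show "\<iota> (tensor_Ob M y z) c
      = Ident C (on_Ob (comp_fctr (s y) (s z)) c) \<cdot>\<^bsub>C\<^esub> (on_Arr (s y) (\<iota> z c) \<cdot>\<^bsub>C\<^esub> \<iota> y c)"
    unfolding module.Ident_left[OF \<iota>_c] by (rule stab_trans_tensor[OF y(1) z(1) c])
qed

lemma degree_lowering_stab_tensor_power: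
  assumes "x \<in> Ob M" "degree_lowering (s x) (\<iota> x)"
  shows "degree_lowering (s (tensor_power M x k)) (\<iota> (tensor_power M x k))"
proof (induction k)
  case 0
  show ?case using degree_lowering_stab_Unit by simp
next
  case (Suc k)
  then show ?case
    using degree_lowering_stab_tensor[OF assms tensor_power_in_Ob[OF assms(1)]] by simp
qed

lemma degree_lowering_stab_generated:
  assumes gen: "generated_by M x" and x: "degree_lowering (s x) (\<iota> x)" and y: "y \<in> Ob M"
  shows "degree_lowering (s y) (\<iota> y)"
proof -
  have x_Ob: "x \<in> Ob M" using gen by (simp add: generated_by_def)
  obtain k where k: "isomorphic M y (tensor_power M x k)"
    using gen y unfolding generated_by_def by blast
  show ?thesis
    by (rule degree_lowering_stab_isomorphic[OF isomorphic_sym[OF k]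
          degree_lowering_stab_tensor_power[OF x_Ob x]])
qed

end

theorem proposition2p8:
  fixes M :: "('mo, 'ma) braided_cat"
    and x :: 'mo
    and C :: "('co, 'ca) cat"
    and act :: "('mo \<times> 'co, 'ma \<times> 'ca, 'co, 'ca) fctr"
    and A :: "('ao, 'aa) ab_cat"
    and T :: "('co, 'ca, 'ao, 'aa) fctr"
  assumes "strict_braided_monoidal_category M"
    and "null_object M (Unit M)"
    and "generated_by M x"
    and "strict_left_module M C act"
    and "abelian_category A"
    and "is_functor C A T"
  shows "degree C A {x} (stab M act) (stab_trans M C act) T =
    degree C A (Ob M) (stab M act) (stab_trans M C act) T"
proof -
  have "{x} \<subseteq> Ob M" using assms(3) by (simp add: generated_by_def)
  moreover have "initial_object M (Unit M)" using assms(2) by (simp add: null_object_def)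
  ultimately interpret left_module_degree M C act A "{x}"
    using assms(4,5) by (intro left_module_degree.intro initial_left_module.intro
        initial_left_module_axioms.intro left_module_degree_axioms.intro)
  have "degree_lowering (stab M act x) (stab_trans M C act x)"
    by (rule degree_lowering_stabiliser) simp
  then show ?thesis
    by (rule degree_eq_if_degree_lowering[OF subset_Ob
          degree_lowering_stab_generated[OF assms(3)] assms(6)])
qed

end
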